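(* Let $(\Xi,d_\Xi)$ be a metric space and let $(H,\|\cdot\|)$ be a separable Hilbert space. Let $\{X_\xi\}_{\xi\in\Xi}$ be a family of square-integrable $H$-valued random variables such that the map $\xi\mapsto X_\xi$ is continuous from $\Xi$ to $L^2_H$. Fix any integer $n\ge1$. For every $\xi\in\Xi$ let $B_\xi:H\to H$ be the (uncentered) covariance operator, $B_\xi(u)=\mathbb{E}[\langle X_\xi,u\rangle X_\xi]$, and let $\lambda_1^\xi,\dots,\lambda_n^\xi,\lambda_{n+1}^\xi$ be its $n+1$ largest eigenvalues, $\lambda_i^\xi=\sigma_i(B_\xi)$. If, for every $\xi\in\Xi$, one has the strict inequality $$\lambda_n^\xi>\lambda_{n+1}^\xi\ge0,$$ then there exists a continuous map $\Xi\to\mathcal{K}(H)$, $\xi\mapsto P_\xi$, such that, for every $\xi\in\Xi$, the operator $P_\xi$ is an orthogonal projection of rank $n$ and $$\mathbb{E}\|X_\xi-P_\xi X_\xi\|^2=\inf_{P\in\mathscr{P}_n}\mathbb{E}\|X_\xi-PX_\xi\|^2,$$ where $\mathscr{P}_n:=\{P\in\mathcal{K}(H):P^2=P,\ P=P^*,\ \operatorname{rank}(P)\le n\}$. Additionally, if $(\Xi,d_\Xi)$ is contractible to a point, then, for $i=1,\dots,n$, there exist continuous maps $v_i:\Xi\to H$ such that, for all $\xi\in\Xi$, one has $\langle v_i(\xi),v_j(\xi)\rangle=\delta_{i,j}$ for all $i,j=1,\dots,n$, and $$P_\xi=\sum_{i=1}^n\langle\cdot,v_i(\xi)\rangle v_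i(\xi).$$
   Context: All random variables are defined on one common complete, separable probability space with expectation $\mathbb{E}$. $L^2_H$ is the space of (classes of) $H$-valued Borel random variables $X$ with $\|X\|_{L^2_H}:=(\mathbb{E}\|X\|^2)^{1/2}<\infty$. $H$-valued expectations are Bochner integrals. $\mathcal{K}(H)$ is the space of compact linear operators $H\to H$ with the operator norm $\|\cdot\|_{op}$. For $A\in\mathcal{K}(H)$, $\sigma_i(A):=\inf\{\|A-L\|_{op}:L\in\mathcal{K}(H),\ \operatorname{rank}(L)\le i-1\}$ is the $i$-th singular value; the operators $B_\xi$ are self-adjoint, positive semidefinite and trace class, so their singular values are their eigenvalues in nonincreasing order counted with multiplicity (padded by zeros if $H$ is finite-dimensional). $\langle\cdot,v\rangle v$ denotes the operator $x\mapsto\langle x,v\rangle v$. *)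

theory Defs
  imports "HOL-Probability.Probability" "HOL-Library.Extended_Nat"
begin

(* A (real) separable Hilbert space is a type of sort
   {real_inner, banach, second_countable_topology}; for metric spaces second countability
   and separability coincide. *)

(* Separability of the measure algebra: density of a countable family of events for the
   pseudometric P(A \<triangle> B).  Equivalently, the sigma-algebra is countably generated up to null
   sets, and also equivalently L^2 is separable. *)
definition separable_measure :: "'w measure \<Rightarrow> bool" where
  "separable_measure M \<longleftrightarrow>
     (\<exists>D. countable D \<and> D \<subseteq> sets M \<and>
        (\<forall>A\<in>sets M. \<forall>e>0. \<exists>B\<in>D. emeasure M ((A - B) \<union> (B - A)) < ennreal e))"

(* Elements of L^2 are represented by functions rather than by classes modulo a.e. equality;
   all notions below depend only on the class. *)
definition square_integrable ::
    "'w measure \<Rightarrow> ('w \<Rightarrow> 'h::{real_inner, banach, second_countable_topology}) \<Rightarrow> bool" where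
  "square_integrable M X \<longleftrightarrow> X \<in> borel_measurable M \<and> integrable M (\<lambda>w. (norm (X w))\<^sup>2)"

definition L2_norm ::
    "'w measure \<Rightarrow> ('w \<Rightarrow> 'h::{real_inner, banach, second_countable_topology}) \<Rightarrow> real" where
  "L2_norm M X = sqrt (\<integral>w. (norm (X w))\<^sup>2 \<partial>M)"

definition L2_continuous_on ::
    "'w measure \<Rightarrow> 'x::metric_space set \<Rightarrow>
     ('x \<Rightarrow> 'w \<Rightarrow> 'h::{real_inner, banach, second_countable_topology}) \<Rightarrow> bool" where
  "L2_continuous_on M S X \<longleftrightarrow>
     (\<forall>x\<in>S. ((\<lambda>y. L2_norm M (\<lambda>w. X y w - X x w)) \<longlongrightarrow> 0) (at x within S))"

definition compact_ops ::
    "('a::real_normed_vector \<Rightarrow>\<^sub>L 'b::real_normed_vector) set" where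
  "compact_ops = {A. compact (closure (blinfun_apply A ` cball 0 1))}"

(* dim is 0 on infinite-dimensional spaces, hence the explicit case for infinite rank. *)
definition op_rank ::
    "('a::real_normed_vector \<Rightarrow>\<^sub>L 'b::real_normed_vector) \<Rightarrow> enat" where
  "op_rank A = (if \<exists>B. finite B \<and> span B = range (blinfun_apply A)
                then enat (dim (range (blinfun_apply A))) else \<infinity>)"

(* Indexed from i = 1. *)
definition sing_val ::
    "nat \<Rightarrow> ('a::real_normed_vector \<Rightarrow>\<^sub>L 'b::real_normed_vector) \<Rightarrow> real" where
  "sing_val i A = (INF L\<in>{L \<in> compact_ops. op_rank L \<le> enat (i - 1)}. norm (A - L))"

(* adjoint is a choice operator; on a Hilbert space a bounded operator has a unique adjoint by
   the Riesz representation theorem, so the choice is the true adjoint. *)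
definition orth_proj :: "('h::{real_inner, banach} \<Rightarrow>\<^sub>L 'h) \<Rightarrow> bool" where
  "orth_proj P \<longleftrightarrow> P o\<^sub>L P = P \<and> adjoint (blinfun_apply P) = blinfun_apply P"

definition proj_rank_le :: "nat \<Rightarrow> ('h::{real_inner, banach} \<Rightarrow>\<^sub>L 'h) set" where
  "proj_rank_le n = {P \<in> compact_ops. orth_proj P \<and> op_rank P \<le> enat n}"

(* Blinfun is meaningful only on bounded linear maps; see cov_op_apply. *)
definition cov_op ::
    "'w measure \<Rightarrow> ('w \<Rightarrow> 'h::{real_inner, banach, second_countable_topology}) \<Rightarrow> 'h \<Rightarrow>\<^sub>L 'h" where
  "cov_op M X = Blinfun (\<lambda>u. \<integral>w. (X w \<bullet> u) *\<^sub>R X w \<partial>M)"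

lemma cov_integrable:
  fixes X :: "'w \<Rightarrow> 'h::{real_inner, banach, second_countable_topology}"
  assumes "square_integrable M X"
  shows "integrable M (\<lambda>w. (X w \<bullet> u) *\<^sub>R X w)"
proof (rule Bochner_Integration.integrable_bound)
  show "integrable M (\<lambda>w. norm u * (norm (X w))\<^sup>2)"
    using assms by (simp add: square_integrable_def)
  have [measurable]: "X \<in> borel_measurable M"
    using assms by (simp add: square_integrable_def)
  show "(\<lambda>w. (X w \<bullet> u) *\<^sub>R X w) \<in> borel_measurable M"
    by measurable
  show "AE w in M. norm ((X w \<bullet> u) *\<^sub>R X w) \<le> norm (norm u * (norm (X w))\<^sup>2)"
  proof (rule AE_I2)
    fix w
    have "\<bar>X w \<bullet> u\<bar> * norm (X w) \<le> (norm (X w) * norm u) * norm (X w)"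
      by (intro mult_right_mono Cauchy_Schwarz_ineq2) auto
    then show "norm ((X w \<bullet> u) *\<^sub>R X w) \<le> norm (norm u * (norm (X w))\<^sup>2)"
      by (simp add: power2_eq_square abs_mult mult_ac)
  qed
qed

lemma cov_op_apply:
  fixes X :: "'w \<Rightarrow> 'h::{real_inner, banach, second_countable_topology}"
  assumes "square_integrable M X"
  shows "blinfun_apply (cov_op M X) u = (\<integral>w. (X w \<bullet> u) *\<^sub>R X w \<partial>M)"
proof -
  have "bounded_linear (\<lambda>u. \<integral>w. (X w \<bullet> u) *\<^sub>R X w \<partial>M)"
  proof (rule bounded_linear_intro[where K = "\<integral>w. (norm (X w))\<^sup>2 \<partial>M"])
    fix x y r
    show "(\<integral>w. (X w \<bullet> (x + y)) *\<^sub>R X w \<partial>M)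
        = (\<integral>w. (X w \<bullet> x) *\<^sub>R X w \<partial>M) + (\<integral>w. (X w \<bullet> y) *\<^sub>R X w \<partial>M)"
      by (simp add: inner_add_right scaleR_add_left cov_integrable[OF assms])
    show "(\<integral>w. (X w \<bullet> (r *\<^sub>R x)) *\<^sub>R X w \<partial>M) = r *\<^sub>R (\<integral>w. (X w \<bullet> x) *\<^sub>R X w \<partial>M)"
      by (simp flip: scaleR_scaleR)
    have "norm (\<integral>w. (X w \<bullet> x) *\<^sub>R X w \<partial>M) \<le> (\<integral>w. norm x * (norm (X w))\<^sup>2 \<partial>M)"
    proof (rule order_trans[OF integral_norm_bound integral_mono])
      show "integrable M (\<lambda>w. norm ((X w \<bullet> x) *\<^sub>R X w))"
        by (intro integrable_norm cov_integrable assms)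
      show "integrable M (\<lambda>w. norm x * (norm (X w))\<^sup>2)"
        using assms by (simp add: square_integrable_def)
      fix w
      have "\<bar>X w \<bullet> x\<bar> * norm (X w) \<le> (norm (X w) * norm x) * norm (X w)"
        by (intro mult_right_mono Cauchy_Schwarz_ineq2) auto
      then show "norm ((X w \<bullet> x) *\<^sub>R X w) \<le> norm x * (norm (X w))\<^sup>2"
        by (simp add: power2_eq_square mult_ac)
    qed
    then show "norm (\<integral>w. (X w \<bullet> x) *\<^sub>R X w \<partial>M) \<le> norm x * (\<integral>w. (norm (X w))\<^sup>2 \<partial>M)"
      by simp
  qed
  then show ?thesis
    by (simp add: cov_op_def bounded_linear_Blinfun_apply)
qed

end

theory Submission
  imports Defs
begin

text \<open>
  Truncating the spectral decomposition shows that \<open>\<sigma>\<^sub>n(B) > \<sigma>\<^sub>n\<^sub>+\<^sub>1(B)\<close> yields an orthonormal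
  family \<open>e\<^sub>1, \<dots>, e\<^sub>n\<close> of eigenvectors of \<open>B\<close> whose eigenvalues exceed a bound \<open>\<mu>\<close> for the quadratic
  form of \<open>B\<close> on the orthogonal complement. The error of an orthogonal projection onto the span of an
  orthonormal family \<open>f\<close> is \<open>E\<parallel>X\<parallel>\<^sup>2 - \<Sum>\<^sub>j \<langle>B f\<^sub>j, f\<^sub>j\<rangle>\<close>, and the gap bounds its excess over the
  minimum from below by a multiple of the squared distance from the projection onto the span of \<open>e\<close>.
  This gives optimality of that projection and, since \<open>B\<close> depends continuously on the
  parameter, its continuity.

  Over a contractible set the projections form a continuous family \<open>P\<close> along the contraction. A fixed
  frame at the end point is transported back by composing finitely many of these projections
  with so small a step that each is injective on the range of the preceding one. The step size is
  chosen as a continuous function of the parameter, so the transported vectors are continuous, and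
  Gram--Schmidt makes them orthonormal.
\<close>

subsection \<open>Finite-rank operators and orthonormal families\<close>

text \<open>The index set is arbitrary because two kinds of sums occur: over \<open>{..<k}\<close>
  for eigenvector expansions and over the values of a simple function for its covariance.\<close>

definition outer_sum :: "'i set \<Rightarrow> ('i \<Rightarrow> 'a::real_inner) \<Rightarrow> ('i \<Rightarrow> 'b::real_normed_vector) \<Rightarrow> 'a \<Rightarrow>\<^sub>L 'b" where
  "outer_sum I a b = (\<Sum>i\<in>I. blinfun_scaleR_left (b i) o\<^sub>L blinfun_inner_left (a i))"

lemma outer_sum_apply: "blinfun_apply (outer_sum I a b) x = (\<Sum>i\<in>I. (x \<bullet> a i) *\<^sub>R b i)"
  by (simp add: outer_sum_def blinfun.sum_left)

text \<open>Induction on \<open>I\<close>: one more index adds a compact segment, and the Minkowski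
  sum of two compact sets is compact.\<close>

lemma compact_box_combinations:
  fixes b :: "'i \<Rightarrow> 'b::real_normed_vector"
  assumes "finite I"
  shows "\<exists>K. compact K \<and> (\<forall>c. (\<forall>i\<in>I. \<bar>c i\<bar> \<le> r i) \<longrightarrow> (\<Sum>i\<in>I. c i *\<^sub>R b i) \<in> K)"
  using assms
proof (induction I)
  case empty
  show ?case by (rule exI[of _ "{0}"]) auto
next
  case (insert j I)
  then obtain K where K: "compact K" "\<And>c. (\<forall>i\<in>I. \<bar>c i\<bar> \<le> r i) \<Longrightarrow> (\<Sum>i\<in>I. c i *\<^sub>R b i) \<in> K"
    by blast
  let ?T = "(\<lambda>t. t *\<^sub>R b j) ` {- r j..r j}"
  have "compact ?T"
    by (intro compact_continuous_image continuous_intros) auto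
  then have "compact {x + y | x y. x \<in> ?T \<and> y \<in> K}"
    using K(1) by (rule compact_sums)
  moreover have "(\<Sum>i\<in>insert j I. c i *\<^sub>R b i) \<in> {x + y | x y. x \<in> ?T \<and> y \<in> K}"
    if "\<forall>i\<in>insert j I. \<bar>c i\<bar> \<le> r i" for c
  proof -
    have "c j *\<^sub>R b j \<in> ?T" using that by (intro imageI) (auto simp: abs_le_iff)
    moreover have "(\<Sum>i\<in>I. c i *\<^sub>R b i) \<in> K" using that by (intro K(2)) auto
    ultimately show ?thesis using insert.hyps by auto
  qed
  ultimately show ?case by blast
qed

text \<open>On the unit ball Cauchy-Schwarz bounds the coefficients \<open>x \<bullet> a i\<close>
  by \<open>norm (a i)\<close>, so the image stays in a compact set of bounded combinations of the
  \<open>b i\<close>.\<close>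

lemma outer_sum_compact:
  fixes a :: "'i \<Rightarrow> 'a::real_inner"
  assumes "finite I"
  shows "outer_sum I a b \<in> compact_ops"
proof -
  obtain K where K: "compact K" "\<And>c. (\<forall>i\<in>I. \<bar>c i\<bar> \<le> norm (a i)) \<Longrightarrow> (\<Sum>i\<in>I. c i *\<^sub>R b i) \<in> K"
    using compact_box_combinations[OF assms, of "\<lambda>i. norm (a i)" b] by blast
  have "blinfun_apply (outer_sum I a b) ` cball 0 1 \<subseteq> K"
  proof clarify
    fix x assume "x \<in> cball (0::'a) 1"
    then have "\<bar>x \<bullet> a i\<bar> \<le> norm (a i)" for i
      using Cauchy_Schwarz_ineq2[of x "a i"] mult_right_mono[of "norm x" 1 "norm (a i)"] by simp
    then show "blinfun_apply (outer_sum I a b) x \<in> K"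
      unfolding outer_sum_apply by (intro K(2)) auto
  qed
  then have "closure (blinfun_apply (outer_sum I a b) ` cball 0 1) \<subseteq> K"
    using K(1) by (intro closure_minimal compact_imp_closed)
  then show ?thesis
    unfolding compact_ops_def using K(1) compact_Int_closed[of K "closure (blinfun_apply (outer_sum I a b) ` cball 0 1)"]
    by (simp add: inf.absorb2)
qed

text \<open>In a complete space a closed set is compact if it is totally bounded, and a finite
  \<open>e / 3\<close>-net for the image under \<open>L\<close> is an \<open>e\<close>-net for the
  image under \<open>A\<close>.\<close>

lemma compact_ops_approx:
  fixes A :: "'a::real_normed_vector \<Rightarrow>\<^sub>L 'b::banach"
  assumes "\<And>e. e > 0 \<Longrightarrow> \<exists>L\<in>compact_ops. norm (A - L) < e"
  shows "A \<in> compact_ops"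
proof -
  let ?S = "closure (blinfun_apply A ` cball 0 1)"
  have "\<exists>k. finite k \<and> ?S \<subseteq> (\<Union>x\<in>k. ball x e)" if "e > 0" for e
  proof -
  obtain L where L: "L \<in> compact_ops" "norm (A - L) < e / 3"
    using assms[of "e / 3"] \<open>e > 0\<close> by auto
  let ?T = "closure (blinfun_apply L ` cball 0 1)"
  have "compact ?T" using L by (simp add: compact_ops_def)
  then obtain k where k: "finite k" "?T \<subseteq> (\<Union>x\<in>k. ball x (e / 3))"
    using \<open>e > 0\<close> unfolding compact_eq_totally_bounded by (metis divide_pos_pos zero_less_numeral)
  have "?S \<subseteq> (\<Union>x\<in>k. ball x e)"
  proof
    fix y assume "y \<in> ?S"
    then obtain x where x: "norm x \<le> 1" "dist (A x) y < e / 3"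
      using \<open>e > 0\<close> unfolding closure_approachable by (force simp: dest: spec[of _ "e / 3"])
    have "L x \<in> ?T" using x by (intro subsetD[OF closure_subset] imageI) auto
    then obtain z where z: "z \<in> k" "dist z (L x) < e / 3" using k by auto
    have "norm ((A - L) x) \<le> norm (A - L) * norm x" by (rule norm_blinfun)
    also have "\<dots> \<le> norm (A - L)" using x by (simp add: mult_left_le)
    finally have "dist (L x) (A x) < e / 3"
      using L by (simp add: dist_norm norm_minus_commute blinfun.diff_left)
    then have "dist z y < e"
      using x(2) z(2) dist_triangle[of z y "L x"] dist_triangle[of "L x" y "A x"] by linarith
    then show "y \<in> (\<Union>x\<in>k. ball x e)" using z(1) by auto
  qed
  then show ?thesis using k(1) by blast
  qed
  then show ?thesis
    by (simp add: compact_ops_def compact_eq_totally_bounded complete_eq_closed)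
qed

text \<open>\<open>op_rank\<close> is finite only if the range itself has a finite spanning set, so
  a basis of the range is counted against \<open>S\<close> by the exchange lemma.\<close>

lemma op_rank_le:
  fixes A :: "'a::real_normed_vector \<Rightarrow>\<^sub>L 'b::real_normed_vector"
  assumes "finite S" "range (blinfun_apply A) \<subseteq> span S" "card S \<le> k"
  shows "op_rank A \<le> enat k"
proof -
  let ?R = "range (blinfun_apply A)"
  obtain B where B: "B \<subseteq> ?R" "independent B" "?R \<subseteq> span B" "card B = dim ?R"
    using basis_exists by metis
  have fin: "finite B" "card B \<le> card S"
    using independent_span_bound[OF assms(1) B(2)] B(1) assms(2) by auto
  have "subspace ?R"
    by (intro linear_subspace_image bounded_linear.linear[OF blinfun.bounded_linear_right] subspace_UNIV)
  then have "span B = ?R"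
    using B by (intro antisym span_minimal) auto
  then show ?thesis
    unfolding op_rank_def using fin B(4) assms(3) by auto
qed

lemma op_rank_leD:
  fixes A :: "'a::real_normed_vector \<Rightarrow>\<^sub>L 'b::real_normed_vector"
  assumes "op_rank A \<le> enat k"
  obtains B where "finite B" "span B = range (blinfun_apply A)" "card B \<le> k"
proof -
  let ?R = "range (blinfun_apply A)"
  have *: "\<exists>B. finite B \<and> span B = ?R"
    using assms unfolding op_rank_def by (auto split: if_splits)
  with assms have d: "dim ?R \<le> k" by (auto simp: op_rank_def)
  from * obtain S where S: "finite S" "span S = ?R" by blast
  obtain B where B: "B \<subseteq> ?R" "independent B" "?R \<subseteq> span B" "card B = dim ?R"
    using basis_exists by metis
  have "finite B" using independent_span_bound[OF S(1) B(2)] B(1) S(2) by auto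
  moreover have "span B = ?R"
    using B(1,3) S(2) by (metis antisym span_minimal subspace_span)
  ultimately show ?thesis using that B(4) d by auto
qed

lemma range_outer_sum: "range (blinfun_apply (outer_sum I a b)) \<subseteq> span (b ` I)"
proof clarify
  fix x
  show "blinfun_apply (outer_sum I a b) x \<in> span (b ` I)"
    unfolding outer_sum_apply by (rule span_sum, rule span_scale, rule span_base) simp
qed

lemma op_rank_outer_sum_le:
  assumes "k \<le> m"
  shows "op_rank (outer_sum {..<k} a b) \<le> enat m"
proof (rule op_rank_le)
  show "finite (b ` {..<k})" by simp
  show "card (b ` {..<k}) \<le> m" using assms card_image_le[of "{..<k}" b] by simp
  show "range (blinfun_apply (outer_sum {..<k} a b)) \<subseteq> span (b ` {..<k})"
    using range_outer_sum[of "{..<k}" a b] .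
qed

section \<open>Orthonormal families and the projections onto their spans\<close>

definition orthonormal_family :: "nat \<Rightarrow> (nat \<Rightarrow> 'h::real_inner) \<Rightarrow> bool" where
  "orthonormal_family k e \<longleftrightarrow> (\<forall>i<k. \<forall>j<k. e i \<bullet> e j = (if i = j then 1 else 0))"

lemma orthonormal_familyD:
  "orthonormal_family k e \<Longrightarrow> i < k \<Longrightarrow> j < k \<Longrightarrow> e i \<bullet> e j = (if i = j then 1 else 0)"
  by (simp add: orthonormal_family_def)

lemma orthonormal_family_norm:
  "orthonormal_family k e \<Longrightarrow> i < k \<Longrightarrow> norm (e i) = 1"
  by (simp add: orthonormal_family_def norm_eq_sqrt_inner)

lemma orthonormal_family_inner_sum:
  assumes "orthonormal_family k e" "j < k"
  shows "(\<Sum>i<k. c i *\<^sub>R e i) \<bullet> e j = c j"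
proof -
  have "(\<Sum>i<k. c i *\<^sub>R e i) \<bullet> e j = (\<Sum>i<k. if i = j then c i else 0)"
    unfolding inner_sum_left using assms by (intro sum.cong) (auto simp: orthonormal_family_def)
  then show ?thesis using assms(2) by simp
qed

lemma orthonormal_family_independent:
  assumes "orthonormal_family k e"
  shows "independent (e ` {..<k})" "card (e ` {..<k}) = k"
proof -
  have "inj_on e {..<k}"
    using assms unfolding orthonormal_family_def inj_on_def by (metis lessThan_iff zero_neq_one)
  then show "card (e ` {..<k}) = k" by (simp add: card_image)
  show "independent (e ` {..<k})"
    using assms
    by (intro pairwise_orthogonal_independent)
       (auto simp: pairwise_def orthogonal_def orthonormal_family_def, metis inner_zero_left zero_neq_one)
qed

text \<open>For an orthonormal family this is the orthogonal projection onto its span; the optimal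
  projections of the theorem are built in this form.\<close>

definition frame_proj :: "nat \<Rightarrow> (nat \<Rightarrow> 'h::real_inner) \<Rightarrow> 'h \<Rightarrow>\<^sub>L 'h" where
  "frame_proj k e = outer_sum {..<k} e e"

lemma frame_proj_apply: "blinfun_apply (frame_proj k e) x = (\<Sum>i<k. (x \<bullet> e i) *\<^sub>R e i)"
  by (simp add: frame_proj_def outer_sum_apply)

lemma frame_proj_inner:
  assumes "orthonormal_family k e" "j < k"
  shows "blinfun_apply (frame_proj k e) x \<bullet> e j = x \<bullet> e j"
  using orthonormal_family_inner_sum[OF assms] by (simp add: frame_proj_apply)

lemma frame_proj_fix:
  assumes "orthonormal_family k e" "x \<in> span (e ` {..<k})"
  shows "blinfun_apply (frame_proj k e) x = x"
  using assms(2)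
proof (induction rule: span_induct_alt)
  case base
  then show ?case by (simp add: blinfun.zero_right)
next
  case (step c x y)
  then obtain j where j: "j < k" "x = e j" by auto
  have "blinfun_apply (frame_proj k e) (e j) = (\<Sum>i<k. if i = j then e i else 0)"
    unfolding frame_proj_apply using assms j by (intro sum.cong) (auto simp: orthonormal_family_def)
  also have "\<dots> = e j" using j by simp
  finally show ?case using step j by (simp add: blinfun.add_right blinfun.scaleR_right)
qed

lemma range_frame_proj:
  assumes "orthonormal_family k e"
  shows "range (blinfun_apply (frame_proj k e)) = span (e ` {..<k})"
proof
  show "range (blinfun_apply (frame_proj k e)) \<subseteq> span (e ` {..<k})"
    unfolding frame_proj_def by (rule range_outer_sum)
  show "span (e ` {..<k}) \<subseteq> range (blinfun_apply (frame_proj k e))"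
    using frame_proj_fix[OF assms] by (metis rangeI subsetI)
qed

lemma frame_proj_compact: "frame_proj k e \<in> compact_ops"
  by (simp add: frame_proj_def outer_sum_compact)

lemma frame_proj_orth_proj:
  fixes e :: "nat \<Rightarrow> 'h::{real_inner,banach}"
  assumes "orthonormal_family k e"
  shows "orth_proj (frame_proj k e)"
  unfolding orth_proj_def
proof
  show "frame_proj k e o\<^sub>L frame_proj k e = frame_proj k e"
    using frame_proj_fix[OF assms] range_frame_proj[OF assms] by (intro blinfun_eqI) auto
  show "adjoint (blinfun_apply (frame_proj k e)) = blinfun_apply (frame_proj k e)"
    by (intro adjoint_unique)
       (auto simp: frame_proj_apply inner_sum_left inner_sum_right inner_commute mult.commute intro!: sum.cong)
qed

lemma op_rank_frame_proj:
  assumes "orthonormal_family k e"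
  shows "op_rank (frame_proj k e) = enat k"
  using orthonormal_family_independent[OF assms] range_frame_proj[OF assms]
  by (auto simp: op_rank_def dim_eq_card_independent)

text \<open>Pythagoras: \<open>?p \<bullet> x\<close> and \<open>?p \<bullet> ?p\<close> both equal
  the sum of the squared coefficients.\<close>

lemma norm_sq_minus_frame_proj:
  assumes "orthonormal_family k e"
  shows "(norm (x - blinfun_apply (frame_proj k e) x))\<^sup>2 = (norm x)\<^sup>2 - (\<Sum>i<k. (x \<bullet> e i)\<^sup>2)"
proof -
  let ?p = "blinfun_apply (frame_proj k e) x"
  have "?p \<bullet> x = (\<Sum>i<k. (x \<bullet> e i)\<^sup>2)"
    unfolding frame_proj_apply inner_sum_left by (simp add: power2_eq_square inner_commute)
  moreover have "?p \<bullet> ?p = (\<Sum>i<k. (x \<bullet> e i)\<^sup>2)"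
    by (subst (2) frame_proj_apply)
       (simp add: inner_sum_right power2_eq_square frame_proj_inner[OF assms])
  ultimately show ?thesis
    by (simp add: power2_norm_eq_inner inner_diff_left inner_diff_right inner_commute)
qed

lemma bessel:
  assumes "orthonormal_family k e"
  shows "(\<Sum>i<k. (x \<bullet> e i)\<^sup>2) \<le> (norm x)\<^sup>2"
  using norm_sq_minus_frame_proj[OF assms, of x] by (metis diff_ge_0_iff_ge zero_le_power2)

text \<open>The left side is the squared distance from \<open>x\<close> to the span. Since the
  projection fixes \<open>y\<close>, the vectors \<open>x\<close> and \<open>x - y\<close> have the
  same residual, whose norm is at most \<open>norm (x - y)\<close>.\<close>

lemma norm_sq_minus_span_ge:
  assumes "orthonormal_family k e" "y \<in> span (e ` {..<k})"
  shows "(norm x)\<^sup>2 - (\<Sum>i<k. (x \<bullet> e i)\<^sup>2) \<le> (norm (x - y))\<^sup>2"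
proof -
  let ?p = "blinfun_apply (frame_proj k e)"
  have "(norm x)\<^sup>2 - (\<Sum>i<k. (x \<bullet> e i)\<^sup>2) = (norm ((x - y) - ?p (x - y)))\<^sup>2"
    using frame_proj_fix[OF assms] by (simp add: norm_sq_minus_frame_proj[OF assms(1), symmetric] blinfun.diff_right)
  also have "\<dots> \<le> (norm (x - y))\<^sup>2"
    by (simp add: norm_sq_minus_frame_proj[OF assms(1)] sum_nonneg)
  finally show ?thesis .
qed

text \<open>An orthogonal spanning set is normalised after its zero vector, if any, is discarded;
  hence \<open>m\<close> may be smaller than \<open>card B\<close>.\<close>

lemma orthonormal_family_of_finite:
  fixes B :: "'h::real_inner set"
  assumes "finite B"
  obtains m f where "m \<le> card B" "orthonormal_family m f" "span (f ` {..<m}) = span B"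
proof -
  obtain C where C: "finite C" "card C \<le> card B" "span C = span B" "pairwise orthogonal C"
    using basis_orthogonal[OF assms] by blast
  let ?D = "C - {0}"
  obtain g where g: "bij_betw g {..<card ?D} ?D"
    using C(1) ex_bij_betw_nat_finite[of ?D] by (auto simp: atLeast0LessThan)
  define f where "f i = (1 / norm (g i)) *\<^sub>R g i" for i
  have gD: "g i \<in> C" "g i \<noteq> 0" if "i < card ?D" for i
    using bij_betwE[OF g] that by auto
  have "orthonormal_family (card ?D) f"
    unfolding orthonormal_family_def
  proof (intro allI impI)
    fix i j assume ij: "i < card ?D" "j < card ?D"
    show "f i \<bullet> f j = (if i = j then 1 else 0)"
    proof (cases "i = j")
      case True
      then show ?thesis using gD(2)[OF ij(1)]
        by (simp add: f_def power2_eq_square flip: power2_norm_eq_inner)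
    next
      case False
      then have "g i \<noteq> g j" using bij_betw_imp_inj_on[OF g] ij by (auto simp: inj_on_def)
      then have "g i \<bullet> g j = 0"
        using C(4) gD(1) ij by (auto simp: pairwise_def orthogonal_def)
      then show ?thesis using False by (simp add: f_def)
    qed
  qed
  moreover have "span (f ` {..<card ?D}) = span (g ` {..<card ?D})"
  proof (rule antisym)
    show "span (f ` {..<card ?D}) \<subseteq> span (g ` {..<card ?D})"
      by (rule span_minimal) (auto simp: f_def intro: span_scale[OF span_base])
    have "g i \<in> span (f ` {..<card ?D})" if "i < card ?D" for i
    proof -
      have "g i = norm (g i) *\<^sub>R f i" using gD(2)[OF that] by (simp add: f_def)
      moreover have "norm (g i) *\<^sub>R f i \<in> span (f ` {..<card ?D})"
        using that by (intro span_scale span_base) auto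
      ultimately show ?thesis by simp
    qed
    then show "span (g ` {..<card ?D}) \<subseteq> span (f ` {..<card ?D})"
      by (intro span_minimal) auto
  qed
  moreover have "span (g ` {..<card ?D}) = span B"
    using bij_betw_imp_surj_on[OF g] C(3) by (simp add: span_delete_0)
  moreover have "card ?D \<le> card B" using C(1,2) by (metis card_Diff1_le order_trans)
  ultimately show ?thesis using that[of "card ?D" f] by simp
qed

subsection \<open>Spectral gap of a compact positive operator\<close>

definition psd_op :: "('h::real_inner \<Rightarrow>\<^sub>L 'h) \<Rightarrow> bool" where
  "psd_op B \<longleftrightarrow> (\<forall>x y. blinfun_apply B x \<bullet> y = x \<bullet> blinfun_apply B y) \<and> (\<forall>x. 0 \<le> blinfun_apply B x \<bullet> x)"

lemma psd_op_sym: "psd_op B \<Longrightarrow> blinfun_apply B x \<bullet> y = x \<bullet> blinfun_apply B y"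
  unfolding psd_op_def by blast

lemma psd_op_nonneg: "psd_op B \<Longrightarrow> 0 \<le> blinfun_apply B x \<bullet> x"
  unfolding psd_op_def by blast

text \<open>The form is nonnegative along the line \<open>x + t *\<^sub>R y\<close>, hence so is a
  quadratic polynomial in \<open>t\<close>; the claim is its discriminant inequality.\<close>

lemma psd_op_cauchy_schwarz:
  assumes "psd_op B"
  shows "(blinfun_apply B x \<bullet> y)\<^sup>2 \<le> (blinfun_apply B x \<bullet> x) * (blinfun_apply B y \<bullet> y)"
proof -
  let ?a = "blinfun_apply B y \<bullet> y" and ?b = "blinfun_apply B x \<bullet> y" and ?c = "blinfun_apply B x \<bullet> x"
  have sym: "blinfun_apply B y \<bullet> x = ?b" using psd_op_sym[OF assms, of y x] by (simp add: inner_commute)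
  have nonneg: "0 \<le> ?c + 2 * t * ?b + t\<^sup>2 * ?a" for t
  proof -
    have "0 \<le> blinfun_apply B (x + t *\<^sub>R y) \<bullet> (x + t *\<^sub>R y)" using assms by (rule psd_op_nonneg)
    also have "\<dots> = ?c + 2 * t * ?b + t\<^sup>2 * ?a"
      using sym by (simp add: blinfun.add_right blinfun.scaleR_right inner_add_left inner_add_right
          power2_eq_square algebra_simps)
    finally show ?thesis .
  qed
  have a: "0 \<le> ?a" using assms by (rule psd_op_nonneg)
  show ?thesis
  proof (cases "?a = 0")
    case True
    have "?b = 0"
    proof (rule ccontr)
      assume "?b \<noteq> 0"
      \<comment> \<open>With \<open>?a = 0\<close> the polynomial is affine, and this
        \<open>t\<close> gives it the value -1.\<close>
      then show False using nonneg[of "- (?c + 1) / (2 * ?b)"] True by (simp add: field_simps)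
    qed
    then show ?thesis using True by simp
  next
    case False
    then have "0 < ?a" using a by simp
    then show ?thesis using nonneg[of "- ?b / ?a"]
      by (simp add: field_simps power2_eq_square)
  qed
qed

text \<open>Cauchy-Schwarz for the form of \<open>B\<close> at \<open>x\<close> and
  \<open>B x\<close> bounds the fourth power of \<open>norm (B x)\<close>, and one factor
  \<open>(norm (B x))\<^sup>2\<close> cancels. A bound on the quadratic form thereby becomes a bound
  on \<open>B x\<close> without a square root of \<open>B\<close>.\<close>

lemma psd_op_norm_sq_le:
  assumes "psd_op B" "0 \<le> c"
    and "blinfun_apply B (blinfun_apply B x) \<bullet> blinfun_apply B x \<le> c * (norm (blinfun_apply B x))\<^sup>2"
  shows "(norm (blinfun_apply B x))\<^sup>2 \<le> c * (blinfun_apply B x \<bullet> x)"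
proof (cases "blinfun_apply B x = 0")
  case False
  let ?y = "blinfun_apply B x"
  have "((norm ?y)\<^sup>2)\<^sup>2 \<le> (?y \<bullet> x) * (blinfun_apply B ?y \<bullet> ?y)"
    using psd_op_cauchy_schwarz[OF assms(1), of x ?y] by (simp add: power2_norm_eq_inner)
  also have "\<dots> \<le> (?y \<bullet> x) * (c * (norm ?y)\<^sup>2)"
    using assms(1,3) by (intro mult_left_mono psd_op_nonneg)
  finally have "(norm ?y)\<^sup>2 * (norm ?y)\<^sup>2 \<le> (c * (?y \<bullet> x)) * (norm ?y)\<^sup>2"
    by (simp add: power2_eq_square mult_ac)
  then show ?thesis by (rule mult_right_le_imp_le) (use False in simp)
qed (use assms in auto)

text \<open>The last clause is the variational property: \<open>l i\<close> is the largest value of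
  the Rayleigh quotient on the complement of the earlier vectors. It makes the \<open>l i\<close>
  the top \<open>k\<close> eigenvalues in nonincreasing order.\<close>

definition spec_frame :: "('h::real_inner \<Rightarrow>\<^sub>L 'h) \<Rightarrow> (nat \<Rightarrow> 'h) \<Rightarrow> (nat \<Rightarrow> real) \<Rightarrow> nat \<Rightarrow> bool" where
  "spec_frame B e l k \<longleftrightarrow> orthonormal_family k e \<and> (\<forall>i<k. blinfun_apply B (e i) = l i *\<^sub>R e i) \<and>
     (\<forall>i<k. \<forall>x. (\<forall>j<i. x \<bullet> e j = 0) \<longrightarrow> blinfun_apply B x \<bullet> x \<le> l i * (norm x)\<^sup>2)"

text \<open>Symmetry moves \<open>B\<close> onto the eigenvector \<open>e j\<close>, so the
  complement of the first \<open>i\<close> eigenvectors is invariant.\<close>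

lemma spec_frame_perp:
  assumes "psd_op B" "spec_frame B e l k" "i \<le> k" "\<forall>j<i. x \<bullet> e j = 0" "j < i"
  shows "blinfun_apply B x \<bullet> e j = 0"
  using assms psd_op_sym[OF assms(1), of x "e j"] by (simp add: spec_frame_def)

lemma spec_frame_rayleigh:
  assumes "spec_frame B e l k" "i < k"
  shows "blinfun_apply B (e i) \<bullet> e i = l i"
  using assms by (simp add: spec_frame_def orthonormal_family_def)

text \<open>The vector \<open>e j\<close> is orthogonal to the first \<open>i\<close> ones, so the
  variational clause for \<open>i\<close> bounds its Rayleigh quotient \<open>l j\<close>.\<close>

lemma spec_frame_antimono:
  assumes "spec_frame B e l k" "i \<le> j" "j < k"
  shows "l j \<le> l i"
proof -
  have "l j = blinfun_apply B (e j) \<bullet> e j" using spec_frame_rayleigh[OF assms(1,3)] by simp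
  also have "\<dots> \<le> l i * (norm (e j))\<^sup>2"
  proof -
    have "\<forall>m<i. e j \<bullet> e m = 0"
      using assms by (auto simp: spec_frame_def orthonormal_family_def)
    then show ?thesis using assms unfolding spec_frame_def by (meson le_less_trans)
  qed
  finally show ?thesis using assms orthonormal_family_norm[of k e j] by (simp add: spec_frame_def)
qed

lemma spec_frame_nonneg:
  assumes "psd_op B" "spec_frame B e l k" "i < k"
  shows "0 \<le> l i"
  using psd_op_nonneg[OF assms(1)] spec_frame_rayleigh[OF assms(2,3)] by metis

lemma spec_frame_extend:
  assumes "psd_op B" "spec_frame B e l k" "norm v = 1" "\<forall>j<k. v \<bullet> e j = 0"
    "blinfun_apply B v = c *\<^sub>R v" "\<And>x. \<forall>j<k. x \<bullet> e j = 0 \<Longrightarrow> blinfun_apply B x \<bullet> x \<le> c * (norm x)\<^sup>2"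
  shows "spec_frame B (e(k := v)) (l(k := c)) (Suc k)"
proof -
  have "v \<bullet> v = 1" using assms(3) by (simp add: norm_eq_1)
  then show ?thesis
    using assms(2,4,5,6)
    by (auto simp: spec_frame_def orthonormal_family_def less_Suc_eq inner_commute)
qed

text \<open>The supremum \<open>c\<close> of the quadratic form over the unit sphere of the
  complement is attained: the vectors of a maximising sequence are asymptotically eigenvectors, and
  compactness of \<open>B\<close> extracts a limit. The vector \<open>x0\<close> makes the sphere
  nonempty.\<close>

lemma exists_max_eigenvector:
  fixes B :: "'h::{real_inner,banach} \<Rightarrow>\<^sub>L 'h"
  assumes "B \<in> compact_ops" "psd_op B" "spec_frame B e l k" "x0 \<noteq> 0" "\<forall>j<k. x0 \<bullet> e j = 0"
  obtains v c where "norm v = 1" "\<forall>j<k. v \<bullet> e j = 0" "blinfun_apply B v = c *\<^sub>R v"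
    "\<And>x. \<forall>j<k. x \<bullet> e j = 0 \<Longrightarrow> blinfun_apply B x \<bullet> x \<le> c * (norm x)\<^sup>2"
proof -
  define V where "V = {x. \<forall>j<k. x \<bullet> e j = 0}"
  define U where "U = {x \<in> V. norm x = 1}"
  define c where "c = (SUP x\<in>U. blinfun_apply B x \<bullet> x)"
  have scale_V: "t *\<^sub>R x \<in> V" if "x \<in> V" for t x using that by (simp add: V_def)
  have unit: "(1 / norm x) *\<^sub>R x \<in> U" if "x \<in> V" "x \<noteq> 0" for x
    using that by (simp add: U_def scale_V)
  have B_V: "blinfun_apply B x \<in> V" if "x \<in> V" for x
    using spec_frame_perp[OF assms(2,3) order_refl] that by (simp add: V_def)
  have "x0 \<in> V" using assms(5) by (simp add: V_def)
  then have ne: "(1 / norm x0) *\<^sub>R x0 \<in> U" using unit assms(4) by blast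
  have bdd: "bdd_above ((\<lambda>x. blinfun_apply B x \<bullet> x) ` U)"
  proof (rule bdd_aboveI2)
    fix x assume "x \<in> U"
    then have "norm x = 1" by (simp add: U_def)
    then show "blinfun_apply B x \<bullet> x \<le> norm B"
      using norm_cauchy_schwarz[of "blinfun_apply B x" x] norm_blinfun[of B x] by simp
  qed
  have le_U: "blinfun_apply B x \<bullet> x \<le> c" if "x \<in> U" for x
    unfolding c_def using that bdd by (rule cSUP_upper)
  have le_V: "blinfun_apply B x \<bullet> x \<le> c * (norm x)\<^sup>2" if "x \<in> V" for x
  proof (cases "x = 0")
    case False
    then show ?thesis using le_U[OF unit[OF that False]]
      by (simp add: blinfun.scaleR_right field_simps power2_eq_square)
  qed (simp add: blinfun.zero_right)
  have c0: "0 \<le> c"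
    using le_U[OF ne] psd_op_nonneg[OF assms(2)] by (rule order_trans[rotated])
  have sq: "(norm (blinfun_apply B x))\<^sup>2 \<le> c * (blinfun_apply B x \<bullet> x)" if "x \<in> V" for x
    using psd_op_norm_sq_le[OF assms(2) c0 le_V[OF B_V[OF that]]] .
  show thesis
  proof (cases "c = 0")
    \<comment> \<open>Here \<open>sq\<close> makes \<open>B\<close> vanish on the complement, so any
      unit vector there is an eigenvector; the limit argument of the other case divides by
      \<open>c\<close>.\<close>
    case True
    let ?v = "(1 / norm x0) *\<^sub>R x0"
    have "(norm (blinfun_apply B ?v))\<^sup>2 \<le> 0" using sq[of ?v] ne True by (simp add: U_def)
    then show thesis using that[of ?v c] ne True le_V by (simp add: U_def V_def)
  next
    case False
    then have "0 < c" using c0 by simp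
    have "\<exists>x\<in>U. c - 1 / real (Suc m) < blinfun_apply B x \<bullet> x" for m
      using less_cSUP_iff[OF _ bdd, of "c - 1 / real (Suc m)"] ne unfolding c_def[symmetric] by auto
    then obtain x where x: "\<And>m. x m \<in> U" "\<And>m. c - 1 / real (Suc m) < blinfun_apply B (x m) \<bullet> x m"
      by metis
    have "\<forall>m. blinfun_apply B (x m) \<in> closure (blinfun_apply B ` cball 0 1)"
      using x(1) by (auto simp: U_def intro!: subsetD[OF closure_subset])
    moreover have "seq_compact (closure (blinfun_apply B ` cball 0 1))"
      using assms(1) by (simp add: compact_ops_def compact_imp_seq_compact)
    ultimately obtain y r where r: "strict_mono (r :: nat \<Rightarrow> nat)"
      and "((\<lambda>m. blinfun_apply B (x m)) \<circ> r) \<longlonglongrightarrow> y"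
      by (metis (no_types, lifting) seq_compactE)
    then have y: "(\<lambda>m. blinfun_apply B (x (r m))) \<longlonglongrightarrow> y" by (simp add: comp_def)
    \<comment> \<open>Expanding the square and inserting the bound \<open>sq\<close> leaves
      \<open>c * (c - ?q)\<close>, which tends to 0 along the maximising sequence.\<close>
    have diff: "(norm (blinfun_apply B (x m) - c *\<^sub>R x m))\<^sup>2 \<le> c / real (Suc m)" for m
    proof -
      let ?q = "blinfun_apply B (x m) \<bullet> x m"
      have "x m \<in> V" "x m \<bullet> x m = 1" using x(1)[of m] by (auto simp: U_def norm_eq_1)
      then have "(norm (blinfun_apply B (x m) - c *\<^sub>R x m))\<^sup>2 = (norm (blinfun_apply B (x m)))\<^sup>2 - 2 * c * ?q + c\<^sup>2"
        unfolding power2_norm_eq_inner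
        by (simp add: inner_diff_left inner_diff_right inner_commute power2_eq_square algebra_simps)
      also have "\<dots> \<le> c * (c - ?q)"
        using sq[OF \<open>x m \<in> V\<close>] by (simp add: power2_eq_square algebra_simps)
      also have "\<dots> \<le> c * (1 / real (Suc m))"
        using x(2)[of m] c0 by (intro mult_left_mono) auto
      finally show ?thesis by simp
    qed
    have "(\<lambda>m. c / real (Suc m)) \<longlonglongrightarrow> 0"
      using tendsto_mult_right_zero[OF LIMSEQ_inverse_real_of_nat, of c] by (simp add: divide_inverse)
    then have "(\<lambda>m. (norm (blinfun_apply B (x m) - c *\<^sub>R x m))\<^sup>2) \<longlonglongrightarrow> 0"
      by (rule Lim_null_comparison[rotated]) (use diff in \<open>auto intro!: always_eventually\<close>)
    then have "(\<lambda>m. sqrt ((norm (blinfun_apply B (x m) - c *\<^sub>R x m))\<^sup>2)) \<longlonglongrightarrow> 0"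
      using tendsto_real_sqrt by force
    then have "(\<lambda>m. blinfun_apply B (x m) - c *\<^sub>R x m) \<longlonglongrightarrow> 0"
      by (simp add: tendsto_norm_zero_iff)
    from LIMSEQ_subseq_LIMSEQ[OF this r]
    have "(\<lambda>m. blinfun_apply B (x (r m)) - c *\<^sub>R x (r m)) \<longlonglongrightarrow> 0" by (simp add: comp_def)
    \<comment> \<open>Compactness makes only the images converge; as
      \<open>B x - c *\<^sub>R x\<close> tends to 0 and \<open>c\<close> is nonzero, the vectors
      \<open>x (r m)\<close> converge as well.\<close>
    from tendsto_diff[OF y this] have "(\<lambda>m. c *\<^sub>R x (r m)) \<longlonglongrightarrow> y" by simp
    from tendsto_scaleR[OF tendsto_const[of "1 / c"] this]
    have lim: "(\<lambda>m. x (r m)) \<longlonglongrightarrow> (1 / c) *\<^sub>R y" using False by simp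
    define v where "v = (1 / c) *\<^sub>R y"
    have "(\<lambda>m. norm (x (r m))) \<longlonglongrightarrow> norm v" unfolding v_def using lim by (rule tendsto_norm)
    then have "norm v = 1" using x(1) by (simp add: U_def LIMSEQ_const_iff)
    moreover have "\<forall>j<k. v \<bullet> e j = 0"
    proof clarify
      fix j assume "j < k"
      have "(\<lambda>m. x (r m) \<bullet> e j) \<longlonglongrightarrow> v \<bullet> e j" unfolding v_def
        by (intro tendsto_inner lim tendsto_const)
      then show "v \<bullet> e j = 0" using x(1) \<open>j < k\<close> by (simp add: U_def V_def LIMSEQ_const_iff)
    qed
    moreover have "blinfun_apply B v = c *\<^sub>R v"
    proof -
      have "(\<lambda>m. blinfun_apply B (x (r m))) \<longlonglongrightarrow> blinfun_apply B v" unfolding v_def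
        by (intro tendsto_intros lim)
      with y have "blinfun_apply B v = y" by (rule LIMSEQ_unique[rotated])
      then show ?thesis using False by (simp add: v_def)
    qed
    ultimately show thesis using that[of v c] le_V by (simp add: V_def)
  qed
qed

section \<open>Comparison of frame eigenvalues with singular values\<close>

lemma norm_diff_bdd_below: "bdd_below ((\<lambda>L. norm (A - L)) ` S)"
  by (rule bdd_belowI2[of _ 0]) simp

text \<open>Subtracting the truncated expansion leaves \<open>B\<close> applied to the component
  orthogonal to the frame. The complement is invariant, so \<open>psd_op_norm_sq_le\<close> turns
  the form bound \<open>c\<close> there into an operator bound.\<close>

lemma spec_frame_residual:
  assumes "psd_op B" "spec_frame B e l k" "0 \<le> c"
    and "\<And>x. \<forall>j<k. x \<bullet> e j = 0 \<Longrightarrow> blinfun_apply B x \<bullet> x \<le> c * (norm x)\<^sup>2"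
  shows "norm (B - outer_sum {..<k} e (\<lambda>i. l i *\<^sub>R e i)) \<le> c"
proof (rule norm_blinfun_bound[OF assms(3)])
  fix x
  have on: "orthonormal_family k e" using assms(2) by (simp add: spec_frame_def)
  let ?y = "x - blinfun_apply (frame_proj k e) x"
  have "blinfun_apply B (blinfun_apply (frame_proj k e) x) = blinfun_apply (outer_sum {..<k} e (\<lambda>i. l i *\<^sub>R e i)) x"
    unfolding frame_proj_apply outer_sum_apply using assms(2)
    by (simp add: blinfun.sum_right blinfun.scaleR_right spec_frame_def)
  then have eq: "blinfun_apply (B - outer_sum {..<k} e (\<lambda>i. l i *\<^sub>R e i)) x = blinfun_apply B ?y"
    by (simp add: blinfun.diff_left blinfun.diff_right)
  have perp: "\<forall>j<k. ?y \<bullet> e j = 0"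
    by (simp add: inner_diff_left frame_proj_inner[OF on])
  have perp': "\<forall>j<k. blinfun_apply B ?y \<bullet> e j = 0"
    using spec_frame_perp[OF assms(1,2) order_refl perp] by blast
  have "(norm (blinfun_apply B ?y))\<^sup>2 \<le> c * (blinfun_apply B ?y \<bullet> ?y)"
    by (rule psd_op_norm_sq_le[OF assms(1,3) assms(4)[OF perp']])
  also have "\<dots> \<le> c * (c * (norm ?y)\<^sup>2)"
    by (intro mult_left_mono assms(3,4) perp)
  also have "(norm ?y)\<^sup>2 \<le> (norm x)\<^sup>2"
    by (simp add: norm_sq_minus_frame_proj[OF on] sum_nonneg)
  then have "c * (c * (norm ?y)\<^sup>2) \<le> c * (c * (norm x)\<^sup>2)"
    by (intro mult_left_mono assms(3))
  finally have "(norm (blinfun_apply B ?y))\<^sup>2 \<le> (c * norm x)\<^sup>2"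
    by (simp add: power2_eq_square mult_ac)
  then show "norm (blinfun_apply (B - outer_sum {..<k} e (\<lambda>i. l i *\<^sub>R e i)) x) \<le> c * norm x"
    unfolding eq by (rule power2_le_imp_le) (use assms(3) in simp)
qed

text \<open>The truncated expansion is a competitor of rank at most \<open>m\<close> in the infimum.
  Allowing \<open>k < m\<close> covers a frame that exhausts the space early.\<close>

lemma sing_val_le_residual:
  fixes B :: "'h::{real_inner,banach} \<Rightarrow>\<^sub>L 'h"
  assumes "psd_op B" "spec_frame B e l k" "k \<le> m" "0 \<le> c"
    and "\<And>x. \<forall>j<k. x \<bullet> e j = 0 \<Longrightarrow> blinfun_apply B x \<bullet> x \<le> c * (norm x)\<^sup>2"
  shows "sing_val (Suc m) B \<le> c"
proof -
  let ?L = "outer_sum {..<k} e (\<lambda>i. l i *\<^sub>R e i)"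
  have "?L \<in> {L \<in> compact_ops. op_rank L \<le> enat (Suc m - 1)}"
    using op_rank_outer_sum_le[OF assms(3)] by (simp add: outer_sum_compact)
  then have "sing_val (Suc m) B \<le> norm (B - ?L)"
    unfolding sing_val_def by (intro cINF_lower norm_diff_bdd_below)
  also have "\<dots> \<le> c" using assms by (intro spec_frame_residual) auto
  finally show ?thesis .
qed

lemma spec_frame_rayleigh_span:
  assumes "spec_frame B e l k" "x \<in> span (e ` {..<k})"
  shows "blinfun_apply B x \<bullet> x = (\<Sum>i<k. l i * (x \<bullet> e i)\<^sup>2)" "(norm x)\<^sup>2 = (\<Sum>i<k. (x \<bullet> e i)\<^sup>2)"
proof -
  have on: "orthonormal_family k e" using assms(1) by (simp add: spec_frame_def)
  have x: "x = (\<Sum>i<k. (x \<bullet> e i) *\<^sub>R e i)"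
    using frame_proj_fix[OF on assms(2)] by (simp add: frame_proj_apply)
  have "blinfun_apply B x = (\<Sum>i<k. (x \<bullet> e i) *\<^sub>R l i *\<^sub>R e i)"
    by (subst x) (use assms(1) in \<open>simp add: blinfun.sum_right blinfun.scaleR_right spec_frame_def\<close>)
  then have "blinfun_apply B x \<bullet> x = (\<Sum>i<k. ((x \<bullet> e i) *\<^sub>R l i *\<^sub>R e i) \<bullet> x)"
    by (simp add: inner_sum_left)
  then show "blinfun_apply B x \<bullet> x = (\<Sum>i<k. l i * (x \<bullet> e i)\<^sup>2)"
    by (simp add: power2_eq_square inner_commute mult_ac)
  show "(norm x)\<^sup>2 = (\<Sum>i<k. (x \<bullet> e i)\<^sup>2)"
    using norm_sq_minus_frame_proj[OF on, of x] frame_proj_fix[OF on assms(2)] by simp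
qed

text \<open>Dimension count: an operator \<open>L\<close> of rank at most \<open>n\<close> kills
  some nonzero \<open>x\<close> in the span of \<open>n + 1\<close> eigenvectors, and there the form
  of \<open>B - L\<close> equals that of \<open>B\<close>, which is at least
  \<open>l n * (norm x)\<^sup>2\<close>.\<close>

lemma sing_val_ge_spec_frame:
  fixes B :: "'h::{real_inner,banach} \<Rightarrow>\<^sub>L 'h"
  assumes "spec_frame B e l (Suc n)"
  shows "l n \<le> sing_val (Suc n) B"
  unfolding sing_val_def
proof (rule cINF_greatest)
  \<comment> \<open>The infimum needs a nonempty set; the empty outer sum is the zero
    operator.\<close>
  show "{L \<in> compact_ops. op_rank (L :: 'h \<Rightarrow>\<^sub>L 'h) \<le> enat (Suc n - 1)} \<noteq> {}"
    using op_rank_outer_sum_le[of 0 n "\<lambda>_. 0::'h" "\<lambda>_. 0::'h"] outer_sum_compact[of "{..<0::nat}"] by fastforce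
  fix L :: "'h \<Rightarrow>\<^sub>L 'h" assume "L \<in> {L \<in> compact_ops. op_rank L \<le> enat (Suc n - 1)}"
  then have "op_rank L \<le> enat n" by simp
  then obtain S where S: "finite S" "span S = range (blinfun_apply L)" "card S \<le> n"
    by (rule op_rank_leD)
  let ?E = "e ` {..<Suc n}"
  have on: "orthonormal_family (Suc n) e" using assms by (simp add: spec_frame_def)
  have lin: "linear (blinfun_apply L)" by (rule bounded_linear.linear[OF blinfun.bounded_linear_right])
  \<comment> \<open>Injectivity would put \<open>Suc n\<close> independent vectors into a range
    spanned by at most \<open>n\<close>.\<close>
  have "\<not> inj_on (blinfun_apply L) (span ?E)"
  proof
    assume inj: "inj_on (blinfun_apply L) (span ?E)"
    have "independent (blinfun_apply L ` ?E)"
      using linear_independent_injective_image[OF lin orthonormal_family_independent(1)[OF on] inj] .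
    then have "card (blinfun_apply L ` ?E) \<le> card S"
      using independent_span_bound[OF S(1)] S(2) by blast
    moreover have "card (blinfun_apply L ` ?E) = Suc n"
      using orthonormal_family_independent(2)[OF on] inj_on_subset[OF inj span_superset]
      by (simp add: card_image)
    ultimately show False using S(3) by simp
  qed
  then obtain x where x: "x \<in> span ?E" "blinfun_apply L x = 0" "x \<noteq> 0"
    using linear_injective_on_subspace_0[OF lin subspace_span, of ?E] by auto
  have "l n * (norm x)\<^sup>2 = (\<Sum>i<Suc n. l n * (x \<bullet> e i)\<^sup>2)"
    using spec_frame_rayleigh_span(2)[OF assms x(1)] by (simp add: sum_distrib_left del: sum.lessThan_Suc)
  also have "\<dots> \<le> (\<Sum>i<Suc n. l i * (x \<bullet> e i)\<^sup>2)"
    using spec_frame_antimono[OF assms] by (intro sum_mono mult_right_mono) auto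
  also have "\<dots> = blinfun_apply (B - L) x \<bullet> x"
    using spec_frame_rayleigh_span(1)[OF assms x(1)] x(2) by (simp add: blinfun.diff_left)
  also have "\<dots> \<le> norm (blinfun_apply (B - L) x) * norm x" by (rule norm_cauchy_schwarz)
  also have "\<dots> \<le> norm (B - L) * norm x * norm x" by (intro mult_right_mono norm_blinfun) simp
  finally show "l n \<le> norm (B - L)" using x(3) by (simp add: power2_eq_square mult.assoc[symmetric])
qed

text \<open>The separating bound \<open>\<mu>\<close> stands in for the next eigenvalue, which has
  no eigenvector when the complement of the frame is trivial.\<close>

definition gap_frame :: "('h::real_inner \<Rightarrow>\<^sub>L 'h) \<Rightarrow> (nat \<Rightarrow> 'h) \<Rightarrow> (nat \<Rightarrow> real) \<Rightarrow> real \<Rightarrow> nat \<Rightarrow> bool" where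
  "gap_frame B e l \<mu> n \<longleftrightarrow> spec_frame B e l n \<and> 0 \<le> \<mu> \<and> (\<forall>i<n. \<mu> < l i) \<and>
     (\<forall>x. (\<forall>j<n. x \<bullet> e j = 0) \<longrightarrow> blinfun_apply B x \<bullet> x \<le> \<mu> * (norm x)\<^sup>2)"

text \<open>Eigenvectors are picked one after the other. Truncation after \<open>n - 1\<close> of
  them gives \<open>sing_val n B \<le> l (n - 1)\<close>, and a further eigenvalue, if there is one,
  is at most \<open>sing_val (n + 1) B\<close>; the gap of the singular values thus separates the
  frame from its complement.\<close>

lemma exists_gap_frame:
  fixes B :: "'h::{real_inner,banach} \<Rightarrow>\<^sub>L 'h"
  assumes "B \<in> compact_ops" "psd_op B" "1 \<le> n" "sing_val (n + 1) B < sing_val n B" "0 \<le> sing_val (n + 1) B"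
  shows "\<exists>e l \<mu>. gap_frame B e l \<mu> n"
proof -
  \<comment> \<open>A frame with trivial complement reproduces \<open>B\<close> exactly, which
    bounds the singular values beyond its length.\<close>
  have triv: "sing_val (Suc m) B \<le> 0"
    if "spec_frame B e l k" "k \<le> m" "\<And>x. \<forall>j<k. x \<bullet> e j = 0 \<Longrightarrow> x = 0" for k m e l
  proof (rule sing_val_le_residual[OF assms(2) that(1,2) order_refl])
    fix x assume "\<forall>j<k. x \<bullet> e j = 0"
    then have "x = 0" by (rule that(3))
    then show "blinfun_apply B x \<bullet> x \<le> 0 * (norm x)\<^sup>2" by simp
  qed
  have "\<exists>e l. spec_frame B e l k" if "k \<le> n" for k
    using that
  proof (induction k)
    case 0
    show ?case by (simp add: spec_frame_def orthonormal_family_def)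
  next
    case (Suc k)
    then obtain e l where el: "spec_frame B e l k" by auto
    \<comment> \<open>If the complement were exhausted before \<open>n\<close> vectors are found,
      \<open>sing_val n B\<close> would be at most 0, against the strict gap above a nonnegative
      value.\<close>
    have "\<exists>x. x \<noteq> 0 \<and> (\<forall>j<k. x \<bullet> e j = 0)"
    proof (rule ccontr)
      assume "\<not> ?thesis"
      then have "sing_val (Suc (n - 1)) B \<le> 0" using Suc.prems by (intro triv[OF el]) auto
      then show False using assms(3,4,5) by simp
    qed
    then obtain x0 where "x0 \<noteq> 0" "\<forall>j<k. x0 \<bullet> e j = 0" by blast
    from exists_max_eigenvector[OF assms(1,2) el this]
    obtain v c where "norm v = 1" "\<forall>j<k. v \<bullet> e j = 0" "blinfun_apply B v = c *\<^sub>R v"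
      "\<And>x. \<forall>j<k. x \<bullet> e j = 0 \<Longrightarrow> blinfun_apply B x \<bullet> x \<le> c * (norm x)\<^sup>2" by metis
    from spec_frame_extend[OF assms(2) el this] show ?case by blast
  qed
  then obtain e l where el: "spec_frame B e l n" by blast
  \<comment> \<open>Dropping the last vector turns the variational clause for index
    \<open>n - 1\<close> into the form bound on the complement of the shorter frame.\<close>
  have el': "spec_frame B e l (n - 1)"
    using el by (auto simp: spec_frame_def orthonormal_family_def)
  have "sing_val (Suc (n - 1)) B \<le> l (n - 1)"
    using el assms(3) spec_frame_nonneg[OF assms(2) el]
    by (intro sing_val_le_residual[OF assms(2) el']) (auto simp: spec_frame_def)
  then have gap: "sing_val (Suc n) B < l i" if "i < n" for i
  proof -
    have "l (n - 1) \<le> l i" using that by (intro spec_frame_antimono[OF el]) auto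
    with \<open>sing_val (Suc (n - 1)) B \<le> l (n - 1)\<close> show ?thesis using assms(3,4) by simp
  qed
  \<comment> \<open>The witness is the next eigenvalue if the complement is nontrivial and 0
    otherwise.\<close>
  have "\<exists>\<mu>. 0 \<le> \<mu> \<and> \<mu> \<le> sing_val (Suc n) B \<and>
      (\<forall>x. (\<forall>j<n. x \<bullet> e j = 0) \<longrightarrow> blinfun_apply B x \<bullet> x \<le> \<mu> * (norm x)\<^sup>2)"
  proof (cases "\<exists>x. x \<noteq> 0 \<and> (\<forall>j<n. x \<bullet> e j = 0)")
    case True
    then obtain x0 where "x0 \<noteq> 0" "\<forall>j<n. x0 \<bullet> e j = 0" by blast
    from exists_max_eigenvector[OF assms(1,2) el this]
    obtain v c where v: "norm v = 1" "\<forall>j<n. v \<bullet> e j = 0" "blinfun_apply B v = c *\<^sub>R v"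
      "\<And>x. \<forall>j<n. x \<bullet> e j = 0 \<Longrightarrow> blinfun_apply B x \<bullet> x \<le> c * (norm x)\<^sup>2" by metis
    note ext = spec_frame_extend[OF assms(2) el this]
    show ?thesis
      using sing_val_ge_spec_frame[OF ext] spec_frame_nonneg[OF assms(2) ext, of n] v(4) by auto
  next
    case False
    then have "\<forall>x. (\<forall>j<n. x \<bullet> e j = 0) \<longrightarrow> blinfun_apply B x \<bullet> x \<le> 0 * (norm x)\<^sup>2"
      by (metis blinfun.zero_right inner_zero_left mult_zero_left order_refl)
    then show ?thesis using assms(5) by (metis Suc_eq_plus1 order_refl)
  qed
  then obtain \<mu> where "0 \<le> \<mu>" "\<mu> \<le> sing_val (Suc n) B"
      "\<forall>x. (\<forall>j<n. x \<bullet> e j = 0) \<longrightarrow> blinfun_apply B x \<bullet> x \<le> \<mu> * (norm x)\<^sup>2" by blast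
  then have "gap_frame B e l \<mu> n"
    unfolding gap_frame_def using el gap by (meson order_le_less_trans)
  then show ?thesis by blast
qed

text \<open>The gap makes the top eigenspace a quantitatively unique maximiser of the compressed trace.\<close>

lemma gap_frame_trace:
  assumes psd: "psd_op B" and B: "gap_frame B e l \<mu> n" and f: "orthonormal_family m f" "m \<le> n"
    and d: "\<And>i. i < n \<Longrightarrow> d \<le> l i - \<mu>" "0 \<le> d"
  shows "d * (\<Sum>i<n. 1 - (\<Sum>j<m. (e i \<bullet> f j)\<^sup>2)) \<le>
    (\<Sum>i<n. blinfun_apply B (e i) \<bullet> e i) - (\<Sum>j<m. blinfun_apply B (f j) \<bullet> f j)"
proof -
  have el: "spec_frame B e l n" and on: "orthonormal_family n e" and \<mu>: "0 \<le> \<mu>"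
    using B by (auto simp: gap_frame_def spec_frame_def)
  \<comment> \<open>Split \<open>f j\<close> into its projection \<open>?p\<close> and the residual
    \<open>?g\<close>. The cross terms vanish because the complement is invariant; \<open>?p\<close>
    contributes the eigenvalue sum and \<open>?g\<close> at most
    \<open>\<mu> * (norm ?g)\<^sup>2\<close>, where Pythagoras eliminates the norm.\<close>
  have step: "blinfun_apply B (f j) \<bullet> f j \<le> (\<Sum>i<n. (l i - \<mu>) * (e i \<bullet> f j)\<^sup>2) + \<mu>" if "j < m" for j
  proof -
    let ?p = "blinfun_apply (frame_proj n e) (f j)"
    let ?g = "f j - ?p"
    have pe: "?p \<in> span (e ` {..<n})" using range_frame_proj[OF on] by blast
    have perp: "\<forall>i<n. ?g \<bullet> e i = 0" by (simp add: inner_diff_left frame_proj_inner[OF on])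
    have perp': "z \<bullet> ?p = 0" if "\<forall>i<n. z \<bullet> e i = 0" for z
      using that by (simp add: frame_proj_apply inner_sum_right)
    have "blinfun_apply B ?g \<bullet> ?p = 0"
      by (intro perp' allI impI) (rule spec_frame_perp[OF psd el order_refl perp])
    moreover have "blinfun_apply B ?p \<bullet> ?g = blinfun_apply B ?g \<bullet> ?p"
      using psd_op_sym[OF psd, of ?p ?g] by (simp only: inner_commute)
    ultimately have "blinfun_apply B (?p + ?g) \<bullet> (?p + ?g) = blinfun_apply B ?p \<bullet> ?p + blinfun_apply B ?g \<bullet> ?g"
      unfolding blinfun.add_right inner_add_left inner_add_right by simp
    then have "blinfun_apply B (f j) \<bullet> f j = blinfun_apply B ?p \<bullet> ?p + blinfun_apply B ?g \<bullet> ?g" by simp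
    also have "blinfun_apply B ?p \<bullet> ?p = (\<Sum>i<n. l i * (e i \<bullet> f j)\<^sup>2)"
      unfolding spec_frame_rayleigh_span(1)[OF el pe]
      by (intro sum.cong refl) (simp add: frame_proj_inner[OF on], simp add: inner_commute)
    also have "blinfun_apply B ?g \<bullet> ?g \<le> \<mu> * (norm ?g)\<^sup>2"
      using B perp by (simp add: gap_frame_def)
    also have "(norm ?g)\<^sup>2 = 1 - (\<Sum>i<n. (e i \<bullet> f j)\<^sup>2)"
      using orthonormal_family_norm[OF f(1) that]
      by (simp add: norm_sq_minus_frame_proj[OF on] inner_commute)
    finally show ?thesis
      by (simp add: algebra_simps sum_subtractf sum_distrib_left)
  qed
  have p: "(\<Sum>j<m. (e i \<bullet> f j)\<^sup>2) \<le> 1" if "i < n" for i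
    using bessel[OF f(1), of "e i"] orthonormal_family_norm[OF on that] by simp
  have "(\<Sum>j<m. blinfun_apply B (f j) \<bullet> f j) \<le> (\<Sum>j<m. (\<Sum>i<n. (l i - \<mu>) * (e i \<bullet> f j)\<^sup>2) + \<mu>)"
    by (intro sum_mono step) simp
  also have "\<dots> = (\<Sum>i<n. (l i - \<mu>) * (\<Sum>j<m. (e i \<bullet> f j)\<^sup>2)) + real m * \<mu>"
    by (simp add: sum.distrib sum_distrib_left sum.swap[of _ "{..<m}"])
  \<comment> \<open>A smaller competitor is padded with \<open>n - m\<close> copies of
    \<open>\<mu>\<close>, which is nonnegative; then \<open>real n * \<mu>\<close> cancels against
    the \<open>\<mu>\<close> in the weights.\<close>
  also have "\<dots> \<le> (\<Sum>i<n. (l i - \<mu>) * (\<Sum>j<m. (e i \<bullet> f j)\<^sup>2)) + real n * \<mu>"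
    using f(2) \<mu> by (intro add_left_mono mult_right_mono) auto
  finally have "(\<Sum>i<n. (l i - \<mu>) * (1 - (\<Sum>j<m. (e i \<bullet> f j)\<^sup>2))) \<le>
      (\<Sum>i<n. l i) - (\<Sum>j<m. blinfun_apply B (f j) \<bullet> f j)"
    by (simp add: right_diff_distrib sum_subtractf)
  \<comment> \<open>Bessel makes every defect nonnegative, so each weight \<open>l i - \<mu>\<close>
    can be lowered to \<open>d\<close>.\<close>
  moreover have "d * (\<Sum>i<n. 1 - (\<Sum>j<m. (e i \<bullet> f j)\<^sup>2)) \<le> (\<Sum>i<n. (l i - \<mu>) * (1 - (\<Sum>j<m. (e i \<bullet> f j)\<^sup>2)))"
    unfolding sum_distrib_left using d p by (intro sum_mono mult_right_mono) auto
  ultimately show ?thesis using spec_frame_rayleigh[OF el] by simp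
qed

text \<open>The sum under the root is half the squared Hilbert-Schmidt distance of the two
  projections. Each summand is the squared distance from \<open>e i\<close> to the span of
  \<open>f\<close>, and the difference \<open>p - q\<close> is written as
  \<open>(1 - q) p - q (1 - p)\<close>.\<close>

lemma norm_frame_proj_diff_le:
  assumes e: "orthonormal_family n e" and f: "orthonormal_family n f"
  shows "norm (frame_proj n e - frame_proj n f) \<le> 2 * real n * sqrt (\<Sum>i<n. 1 - (\<Sum>j<n. (e i \<bullet> f j)\<^sup>2))"
proof -
  define S where "S = (\<Sum>i<n. 1 - (\<Sum>j<n. (e i \<bullet> f j)\<^sup>2))"
  define p q where "p = blinfun_apply (frame_proj n e)" and "q = blinfun_apply (frame_proj n f)"
  \<comment> \<open>Stated for arbitrary families since it is applied in both directions;
    \<open>S'\<close> shows that the sum is symmetric in \<open>e\<close> and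
    \<open>f\<close>.\<close>
  have main: "norm (u i - blinfun_apply (frame_proj n w) (u i)) \<le> sqrt S"
    if u: "orthonormal_family n u" and w: "orthonormal_family n w" and i: "i < n"
      and S: "S = (\<Sum>i<n. 1 - (\<Sum>j<n. (u i \<bullet> w j)\<^sup>2))" for u w i
  proof -
    have b: "0 \<le> 1 - (\<Sum>j<n. (u i \<bullet> w j)\<^sup>2)" if "i < n" for i
      using bessel[OF w, of "u i"] orthonormal_family_norm[OF u that] by simp
    have "(norm (u i - blinfun_apply (frame_proj n w) (u i)))\<^sup>2 = 1 - (\<Sum>j<n. (u i \<bullet> w j)\<^sup>2)"
      using orthonormal_family_norm[OF u i] by (simp add: norm_sq_minus_frame_proj[OF w])
    also have "\<dots> \<le> S" unfolding S using b i by (intro member_le_sum) auto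
    finally show ?thesis by (simp add: real_le_rsqrt)
  qed
  have S': "S = (\<Sum>i<n. 1 - (\<Sum>j<n. (f i \<bullet> e j)\<^sup>2))"
    unfolding S_def sum_subtractf by (subst sum.swap) (simp add: inner_commute)
  have S0: "0 \<le> S" unfolding S_def
    using bessel[OF f] orthonormal_family_norm[OF e] by (intro sum_nonneg) (metis diff_ge_0_iff_ge lessThan_iff one_power2)
  have "norm (frame_proj n e - frame_proj n f) \<le> 2 * real n * sqrt S"
  proof (rule norm_blinfun_bound)
    show "0 \<le> 2 * real n * sqrt S" using S0 by simp
    fix x
    have self: "blinfun_apply (frame_proj n e) y \<bullet> z = y \<bullet> blinfun_apply (frame_proj n e) z" for y z
      by (auto simp: frame_proj_apply inner_sum_left inner_sum_right inner_commute mult.commute intro!: sum.cong)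
    have 1: "norm (p x - q (p x)) \<le> real n * (sqrt S * norm x)"
    proof -
      have "p x - q (p x) = (\<Sum>i<n. (x \<bullet> e i) *\<^sub>R (e i - q (e i)))"
        unfolding p_def q_def by (simp add: frame_proj_apply[of n e] blinfun.sum_right blinfun.scaleR_right scaleR_diff_right sum_subtractf)
      also have "norm \<dots> \<le> (\<Sum>i<n. sqrt S * norm x)"
      proof (rule sum_norm_le)
        fix i assume "i \<in> {..<n}"
        then have i: "i < n" by simp
        have "\<bar>x \<bullet> e i\<bar> \<le> norm x"
          using Cauchy_Schwarz_ineq2[of x "e i"] orthonormal_family_norm[OF e i] by simp
        then show "norm ((x \<bullet> e i) *\<^sub>R (e i - q (e i))) \<le> sqrt S * norm x"
          using mult_mono[OF main[OF e f i S_def] \<open>\<bar>x \<bullet> e i\<bar> \<le> norm x\<close>] S0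
          by (simp add: q_def mult.commute)
      qed
      finally show ?thesis by simp
    qed
    have 2: "norm (q (x - p x)) \<le> real n * (sqrt S * norm x)"
    proof -
      have "norm (q (x - p x)) = norm (\<Sum>j<n. ((x - p x) \<bullet> f j) *\<^sub>R f j)"
        by (simp add: q_def frame_proj_apply)
      also have "\<dots> \<le> (\<Sum>j<n. sqrt S * norm x)"
      proof (rule sum_norm_le)
        fix j assume "j \<in> {..<n}"
        then have j: "j < n" by simp
        \<comment> \<open>By self-adjointness the residual moves from \<open>x\<close> to
          \<open>f j\<close>, where \<open>main\<close> applies with the roles exchanged.\<close>
        have "(x - p x) \<bullet> f j = x \<bullet> (f j - p (f j))"
          by (simp add: p_def inner_diff_left inner_diff_right self)
        then have "\<bar>(x - p x) \<bullet> f j\<bar> \<le> norm x * norm (f j - p (f j))"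
          using Cauchy_Schwarz_ineq2 by metis
        also have "\<dots> \<le> norm x * sqrt S"
          using main[OF f e j S'] by (intro mult_left_mono) (auto simp: p_def)
        finally show "norm (((x - p x) \<bullet> f j) *\<^sub>R f j) \<le> sqrt S * norm x"
          using orthonormal_family_norm[OF f j] by (simp add: mult.commute)
      qed
      finally show ?thesis by simp
    qed
    have "blinfun_apply (frame_proj n e - frame_proj n f) x = (p x - q (p x)) - q (x - p x)"
      by (simp add: p_def q_def blinfun.diff_left blinfun.diff_right)
    then show "norm (blinfun_apply (frame_proj n e - frame_proj n f) x) \<le> 2 * real n * sqrt S * norm x"
      using norm_triangle_ineq4[of "p x - q (p x)" "q (x - p x)"] 1 2 by (simp add: mult_ac)
  qed
  then show ?thesis by (simp add: S_def)
qed

text \<open>The trace inequality for \<open>B\<close> with competitor \<open>f\<close> is added to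
  the one for \<open>C\<close> with competitor \<open>e\<close> and constant 0. The right side
  becomes the trace of \<open>B - C\<close> over \<open>e\<close> plus that of \<open>C - B\<close>
  over \<open>f\<close>, each at most \<open>n * norm (B - C)\<close>.\<close>

lemma gap_frame_perturb:
  assumes "psd_op B" "psd_op C" "gap_frame B e l \<mu> n" "gap_frame C f l' \<mu>' n"
    and "\<And>i. i < n \<Longrightarrow> d \<le> l i - \<mu>" "0 \<le> d"
  shows "d * (\<Sum>i<n. 1 - (\<Sum>j<n. (e i \<bullet> f j)\<^sup>2)) \<le> 2 * real n * norm (B - C)"
proof -
  have e: "orthonormal_family n e" and f: "orthonormal_family n f"
    using assms(3,4) by (auto simp: gap_frame_def spec_frame_def)
  have bound: "(\<Sum>i<n. blinfun_apply D (u i) \<bullet> u i) \<le> real n * norm D" if "orthonormal_family n u" for D u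
  proof -
    have "blinfun_apply D (u i) \<bullet> u i \<le> norm D" if "i < n" for i
      using norm_cauchy_schwarz[of "blinfun_apply D (u i)" "u i"] norm_blinfun[of D "u i"]
        orthonormal_family_norm[OF \<open>orthonormal_family n u\<close> that] by simp
    then have "(\<Sum>i<n. blinfun_apply D (u i) \<bullet> u i) \<le> (\<Sum>i<n. norm D)" by (intro sum_mono) auto
    then show ?thesis by simp
  qed
  have "0 * (\<Sum>i<n. 1 - (\<Sum>j<n. (f i \<bullet> e j)\<^sup>2)) \<le>
      (\<Sum>i<n. blinfun_apply C (f i) \<bullet> f i) - (\<Sum>j<n. blinfun_apply C (e j) \<bullet> e j)"
    using assms(4) by (intro gap_frame_trace[OF assms(2,4) e order_refl]) (auto simp: gap_frame_def less_imp_le)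
  moreover note gap_frame_trace[OF assms(1,3) f order_refl assms(5,6)]
  moreover note bound[OF e, of "B - C"] bound[OF f, of "C - B"]
  ultimately show ?thesis
    by (simp add: blinfun.diff_left inner_diff_left sum_subtractf norm_minus_commute[of C B])
qed

text \<open>The frames are arbitrary at each point and may jump; only their projections vary
  continuously. The perturbation bound involves the gap at the base point \<open>x\<close> alone, so
  \<open>d\<close> stays constant as \<open>y\<close> tends to \<open>x\<close>.\<close>

lemma continuous_on_gap_frame_proj:
  fixes B :: "'x::metric_space \<Rightarrow> ('h::real_inner \<Rightarrow>\<^sub>L 'h)"
  assumes cont: "continuous_on T B" and psd: "\<And>x. x \<in> T \<Longrightarrow> psd_op (B x)"
    and gap: "\<And>x. x \<in> T \<Longrightarrow> gap_frame (B x) (e x) (l x) (\<mu> x) n"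
  shows "continuous_on T (\<lambda>x. frame_proj n (e x))"
  unfolding continuous_on
proof
  fix x assume x: "x \<in> T"
  \<comment> \<open>The inserted 1 keeps the set nonempty, so that the minimum is meaningful also
    for \<open>n = 0\<close>.\<close>
  define d where "d = Min (insert 1 ((\<lambda>i. l x i - \<mu> x) ` {..<n}))"
  have d: "0 < d" "\<And>i. i < n \<Longrightarrow> d \<le> l x i - \<mu> x"
    using gap[OF x] unfolding d_def gap_frame_def by (auto simp: Min_gr_iff)
  have bound: "norm (frame_proj n (e y) - frame_proj n (e x)) \<le> 2 * real n * sqrt (2 * real n * norm (B y - B x) / d)"
    if y: "y \<in> T" for y
  proof -
    have "d * (\<Sum>i<n. 1 - (\<Sum>j<n. (e x i \<bullet> e y j)\<^sup>2)) \<le> 2 * real n * norm (B x - B y)"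
      using d by (intro gap_frame_perturb[OF psd[OF x] psd[OF y] gap[OF x] gap[OF y]]) auto
    then have "(\<Sum>i<n. 1 - (\<Sum>j<n. (e x i \<bullet> e y j)\<^sup>2)) \<le> 2 * real n * norm (B y - B x) / d"
      using d(1) by (simp add: field_simps norm_minus_commute)
    then have "2 * real n * sqrt (\<Sum>i<n. 1 - (\<Sum>j<n. (e x i \<bullet> e y j)\<^sup>2)) \<le> 2 * real n * sqrt (2 * real n * norm (B y - B x) / d)"
      by (intro mult_left_mono) auto
    then show ?thesis
      using norm_frame_proj_diff_le[of n "e x" "e y"] gap[OF x] gap[OF y]
      by (simp add: gap_frame_def spec_frame_def norm_minus_commute)
  qed
  have "((\<lambda>y. norm (B y - B x)) \<longlongrightarrow> 0) (at x within T)"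
    using cont x unfolding continuous_on by (simp add: tendsto_norm_zero_iff LIM_zero)
  then have "((\<lambda>y. 2 * real n * sqrt (2 * real n * norm (B y - B x) / d)) \<longlongrightarrow> 2 * real n * sqrt (2 * real n * 0 / d)) (at x within T)"
    using d(1) by (intro tendsto_intros) auto
  then have "((\<lambda>y. norm (frame_proj n (e y) - frame_proj n (e x))) \<longlongrightarrow> 0) (at x within T)"
    by (rule Lim_null_comparison[rotated, OF tendsto_eq_rhs]) (auto simp: eventually_at_filter bound)
  then show "((\<lambda>y. frame_proj n (e y)) \<longlongrightarrow> frame_proj n (e x)) (at x within T)"
    by (simp add: LIM_zero_iff tendsto_norm_zero_iff)
qed

subsection \<open>Covariance operators\<close>

lemma square_integrable_diff:
  assumes "square_integrable M X" "square_integrable M Y"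
  shows "square_integrable M (\<lambda>w. X w - Y w)"
proof -
  have [measurable]: "X \<in> borel_measurable M" "Y \<in> borel_measurable M"
    using assms by (auto simp: square_integrable_def)
  have "integrable M (\<lambda>w. 2 * (norm (X w))\<^sup>2 + 2 * (norm (Y w))\<^sup>2)"
    using assms by (auto simp: square_integrable_def)
  then have "integrable M (\<lambda>w. (norm (X w - Y w))\<^sup>2)"
  proof (rule Bochner_Integration.integrable_bound)
    show "AE w in M. norm ((norm (X w - Y w))\<^sup>2) \<le> norm (2 * (norm (X w))\<^sup>2 + 2 * (norm (Y w))\<^sup>2)"
    proof (rule AE_I2)
      fix w
      have "(norm (X w - Y w))\<^sup>2 \<le> (norm (X w) + norm (Y w))\<^sup>2"
        by (intro power_mono norm_triangle_ineq4) simp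
      also have "\<dots> \<le> 2 * (norm (X w))\<^sup>2 + 2 * (norm (Y w))\<^sup>2"
        using zero_le_power2[of "norm (X w) - norm (Y w)"] by (simp add: power2_eq_square algebra_simps)
      finally show "norm ((norm (X w - Y w))\<^sup>2) \<le> norm (2 * (norm (X w))\<^sup>2 + 2 * (norm (Y w))\<^sup>2)" by simp
    qed
  qed measurable
  then show ?thesis by (simp add: square_integrable_def)
qed

lemma cov_op_inner:
  assumes "square_integrable M X"
  shows "blinfun_apply (cov_op M X) u \<bullet> v = (\<integral>w. (X w \<bullet> u) * (X w \<bullet> v) \<partial>M)"
    "integrable M (\<lambda>w. (X w \<bullet> u) * (X w \<bullet> v))"
proof -
  note int = cov_integrable[OF assms, of u]
  from integrable_inner_left[OF int, of v] show "integrable M (\<lambda>w. (X w \<bullet> u) * (X w \<bullet> v))" by simp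
  from integral_inner_left[OF int, of v]
  show "blinfun_apply (cov_op M X) u \<bullet> v = (\<integral>w. (X w \<bullet> u) * (X w \<bullet> v) \<partial>M)"
    by (simp add: cov_op_apply[OF assms])
qed

lemma psd_op_cov_op:
  assumes "square_integrable M X"
  shows "psd_op (cov_op M X)"
  unfolding psd_op_def
proof (intro conjI allI)
  fix x y
  show "blinfun_apply (cov_op M X) x \<bullet> y = x \<bullet> blinfun_apply (cov_op M X) y"
    unfolding inner_commute[of x "blinfun_apply (cov_op M X) y"] cov_op_inner(1)[OF assms]
    by (simp add: mult.commute)
  show "0 \<le> blinfun_apply (cov_op M X) x \<bullet> x" by (simp add: cov_op_inner(1)[OF assms])
qed

text \<open>With \<open>D = X - Y\<close> the integrand is
  \<open>(X \<bullet> u) D + (D \<bullet> u) X - (D \<bullet> u) D\<close>. The weighted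
  arithmetic-geometric mean inequality splits the mixed products, so that a small
  \<open>\<epsilon>\<close> controls the part that does not shrink with \<open>D\<close>.\<close>

lemma norm_cov_op_diff_le:
  fixes X Y :: "'w \<Rightarrow> 'h::{real_inner, banach, second_countable_topology}"
  assumes X: "square_integrable M X" and Y: "square_integrable M Y" and "0 < \<epsilon>"
  shows "norm (cov_op M X - cov_op M Y) \<le>
    (1 + 1 / \<epsilon>) * (\<integral>w. (norm (X w - Y w))\<^sup>2 \<partial>M) + \<epsilon> * (\<integral>w. (norm (X w))\<^sup>2 \<partial>M)"
    (is "_ \<le> ?K")
proof (rule norm_blinfun_bound)
  show "0 \<le> ?K" using assms(3) by simp
  fix u :: 'h
  let ?h = "\<lambda>w. norm u * ((1 + 1 / \<epsilon>) * (norm (X w - Y w))\<^sup>2 + \<epsilon> * (norm (X w))\<^sup>2)"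
  have intX: "integrable M (\<lambda>w. (norm (X w))\<^sup>2)" and intD: "integrable M (\<lambda>w. (norm (X w - Y w))\<^sup>2)"
    using X square_integrable_diff[OF X Y] by (auto simp: square_integrable_def)
  have "blinfun_apply (cov_op M X - cov_op M Y) u = (\<integral>w. (X w \<bullet> u) *\<^sub>R X w - (Y w \<bullet> u) *\<^sub>R Y w \<partial>M)"
    using cov_integrable[OF X] cov_integrable[OF Y]
    by (simp add: blinfun.diff_left cov_op_apply[OF X] cov_op_apply[OF Y])
  also have "norm \<dots> \<le> (\<integral>w. ?h w \<partial>M)"
  proof (rule order_trans[OF integral_norm_bound integral_mono])
    show "integrable M (\<lambda>w. norm ((X w \<bullet> u) *\<^sub>R X w - (Y w \<bullet> u) *\<^sub>R Y w))"
      using cov_integrable[OF X] cov_integrable[OF Y] by (intro integrable_norm Bochner_Integration.integrable_diff)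
    show "integrable M ?h" using intX intD by simp
    fix w
    define D where "D = X w - Y w"
    have "2 * (norm (X w) * norm D) \<le> \<epsilon> * (norm (X w))\<^sup>2 + (norm D)\<^sup>2 / \<epsilon>"
    proof -
      have "0 \<le> (\<epsilon> * norm (X w) - norm D)\<^sup>2 / \<epsilon>" using assms(3) by simp
      also have "\<dots> = \<epsilon> * (norm (X w))\<^sup>2 + (norm D)\<^sup>2 / \<epsilon> - 2 * (norm (X w) * norm D)"
        using assms(3) by (simp add: power2_eq_square field_simps)
      finally show ?thesis by simp
    qed
    note amgm = this
    have "(X w \<bullet> u) *\<^sub>R X w - (Y w \<bullet> u) *\<^sub>R Y w = (X w \<bullet> u) *\<^sub>R D + (D \<bullet> u) *\<^sub>R X w - (D \<bullet> u) *\<^sub>R D"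
      by (simp add: D_def algebra_simps inner_diff_left)
    then have "norm ((X w \<bullet> u) *\<^sub>R X w - (Y w \<bullet> u) *\<^sub>R Y w) \<le>
        \<bar>X w \<bullet> u\<bar> * norm D + \<bar>D \<bullet> u\<bar> * norm (X w) + \<bar>D \<bullet> u\<bar> * norm D"
      using norm_triangle_ineq4[of "(X w \<bullet> u) *\<^sub>R D + (D \<bullet> u) *\<^sub>R X w" "(D \<bullet> u) *\<^sub>R D"]
        norm_triangle_ineq[of "(X w \<bullet> u) *\<^sub>R D" "(D \<bullet> u) *\<^sub>R X w"] by simp
    also have "\<dots> \<le> (norm (X w) * norm u) * norm D + (norm D * norm u) * norm (X w) + (norm D * norm u) * norm D"
      by (intro add_mono mult_right_mono Cauchy_Schwarz_ineq2) auto
    also have "\<dots> = norm u * (2 * (norm (X w) * norm D) + (norm D)\<^sup>2)"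
      by (simp add: power2_eq_square algebra_simps)
    also have "\<dots> \<le> norm u * ((1 + 1 / \<epsilon>) * (norm D)\<^sup>2 + \<epsilon> * (norm (X w))\<^sup>2)"
      using amgm by (intro mult_left_mono) (auto simp: algebra_simps)
    finally show "norm ((X w \<bullet> u) *\<^sub>R X w - (Y w \<bullet> u) *\<^sub>R Y w) \<le> ?h w" by (simp add: D_def)
  qed
  also have "(\<integral>w. ?h w \<partial>M) = ?K * norm u"
    using intX intD by simp
  finally show "norm (blinfun_apply (cov_op M X - cov_op M Y) u) \<le> ?K * norm u" .
qed

lemma cov_op_close:
  assumes X: "square_integrable M X" and "0 < e"
  obtains d where "0 < d"
    "\<And>Y. square_integrable M Y \<Longrightarrow> (\<integral>w. (norm (X w - Y w))\<^sup>2 \<partial>M) < d \<Longrightarrow> norm (cov_op M X - cov_op M Y) < e"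
proof -
  define A where "A = (\<integral>w. (norm (X w))\<^sup>2 \<partial>M)"
  \<comment> \<open>Chosen so that \<open>\<epsilon> * A\<close> takes at most half of
    \<open>e\<close>; the summand 1 keeps the denominator positive.\<close>
  define \<epsilon> where "\<epsilon> = e / (2 * (A + 1))"
  have A: "0 \<le> A" unfolding A_def by simp
  then have \<epsilon>: "0 < \<epsilon>" using assms(2) by (simp add: \<epsilon>_def)
  have "\<epsilon> * A \<le> e / 2"
    using A assms(2) by (simp add: \<epsilon>_def field_simps)
  show thesis
  proof (rule that[of "e / 2 / (1 + 1 / \<epsilon>)"])
    have pos: "0 < 1 + 1 / \<epsilon>" using \<epsilon> by (simp add: add_pos_pos)
    then show "0 < e / 2 / (1 + 1 / \<epsilon>)" using assms(2) by simp
    fix Y assume Y: "square_integrable M Y" "(\<integral>w. (norm (X w - Y w))\<^sup>2 \<partial>M) < e / 2 / (1 + 1 / \<epsilon>)"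
    then have "(1 + 1 / \<epsilon>) * (\<integral>w. (norm (X w - Y w))\<^sup>2 \<partial>M) < e / 2"
      using pos by (simp only: pos_less_divide_eq mult.commute)
    then show "norm (cov_op M X - cov_op M Y) < e"
      using norm_cov_op_diff_le[OF X Y(1) \<epsilon>] \<open>\<epsilon> * A \<le> e / 2\<close> unfolding A_def[symmetric] by linarith
  qed
qed

text \<open>A simple \<open>s\<close> has finitely many values, so the integral is a finite sum over
  them, weighted by the measures of the fibres.\<close>

lemma (in finite_measure) cov_op_simple_compact:
  assumes s: "simple_function M s" and sq: "square_integrable M s"
  shows "cov_op M s \<in> compact_ops"
proof -
  let ?R = "s ` space M"
  have fin: "finite ?R" using s by (rule simple_functionD)
  have sets: "s -` {y} \<inter> space M \<in> sets M" for y using s by (rule simple_functionD)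
  have "cov_op M s = outer_sum ?R id (\<lambda>y. measure M (s -` {y} \<inter> space M) *\<^sub>R y)"
  proof (rule blinfun_eqI)
    fix u
    have "blinfun_apply (cov_op M s) u = (\<integral>w. (\<Sum>y\<in>?R. indicator (s -` {y} \<inter> space M) w *\<^sub>R ((y \<bullet> u) *\<^sub>R y)) \<partial>M)"
      unfolding cov_op_apply[OF sq]
    proof (rule Bochner_Integration.integral_cong[OF refl])
      fix w assume w: "w \<in> space M"
      have "(\<Sum>y\<in>?R. indicator (s -` {y} \<inter> space M) w *\<^sub>R ((y \<bullet> u) *\<^sub>R y)) =
          (\<Sum>y\<in>?R. if y = s w then (y \<bullet> u) *\<^sub>R y else 0)"
        using w by (intro sum.cong) (auto simp: indicator_def)
      then show "(s w \<bullet> u) *\<^sub>R s w = (\<Sum>y\<in>?R. indicator (s -` {y} \<inter> space M) w *\<^sub>R ((y \<bullet> u) *\<^sub>R y))"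
        using w fin by (simp add: sum.delta)
    qed
    also have "\<dots> = (\<Sum>y\<in>?R. measure M (s -` {y} \<inter> space M) *\<^sub>R ((y \<bullet> u) *\<^sub>R y))"
      using sets by (subst Bochner_Integration.integral_sum)
         (auto simp: less_top[symmetric] emeasure_eq_measure intro!: sum.cong)
    finally show "blinfun_apply (cov_op M s) u =
        blinfun_apply (outer_sum ?R id (\<lambda>y. measure M (s -` {y} \<inter> space M) *\<^sub>R y)) u"
      by (simp add: outer_sum_apply inner_commute mult.commute)
  qed
  then show ?thesis using outer_sum_compact[OF fin] by simp
qed

text \<open>Simple functions that approximate \<open>X\<close> in the mean square have finite-rank
  covariance operators, and compactness survives norm limits.\<close>

lemma (in finite_measure) cov_op_compact:
  assumes X: "square_integrable M X"
  shows "cov_op M X \<in> compact_ops"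
proof (rule compact_ops_approx)
  fix e :: real assume "0 < e"
  with X obtain d where d: "0 < d"
    "\<And>Y. square_integrable M Y \<Longrightarrow> (\<integral>w. (norm (X w - Y w))\<^sup>2 \<partial>M) < d \<Longrightarrow> norm (cov_op M X - cov_op M Y) < e"
    by (rule cov_op_close) blast
  have [measurable]: "X \<in> borel_measurable M" and int: "integrable M (\<lambda>w. (norm (X w))\<^sup>2)"
    using X by (auto simp: square_integrable_def)
  obtain s where s: "\<And>i. simple_function M (s i)" "\<And>w. w \<in> space M \<Longrightarrow> (\<lambda>i. s i w) \<longlonglongrightarrow> X w"
    "\<And>i w. w \<in> space M \<Longrightarrow> norm (s i w) \<le> 2 * norm (X w)"
    using borel_measurable_implies_sequence_metric[of X M 0] by simp metis
  have [measurable]: "s i \<in> borel_measurable M" for i using s(1) by (rule borel_measurable_simple_function)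
  have sq: "square_integrable M (s i)" for i
  proof -
    have "integrable M (\<lambda>w. (norm (s i w))\<^sup>2)"
    proof (rule Bochner_Integration.integrable_bound[of _ "\<lambda>w. 4 * (norm (X w))\<^sup>2"])
      show "AE w in M. norm ((norm (s i w))\<^sup>2) \<le> norm (4 * (norm (X w))\<^sup>2)"
        using power_mono[OF s(3), of _ i 2] by (intro AE_I2) (simp add: power_mult_distrib)
    qed (use int in auto)
    then show ?thesis by (simp add: square_integrable_def)
  qed
  have "(\<lambda>i. \<integral>w. (norm (X w - s i w))\<^sup>2 \<partial>M) \<longlonglongrightarrow> (\<integral>w. 0 \<partial>M)"
  \<comment> \<open>Since \<open>norm (s i w) \<le> 2 * norm (X w)\<close>, the difference is at
    most \<open>3 * norm (X w)\<close>, which gives the factor 9.\<close>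
  proof (rule integral_dominated_convergence[where w="\<lambda>w. 9 * (norm (X w))\<^sup>2"])
    show "AE w in M. (\<lambda>i. (norm (X w - s i w))\<^sup>2) \<longlonglongrightarrow> 0"
    proof (rule AE_I2)
      fix w assume "w \<in> space M"
      from tendsto_diff[OF tendsto_const s(2)[OF this], of "X w"]
      have "(\<lambda>i. norm (X w - s i w)) \<longlonglongrightarrow> 0" by (simp add: tendsto_norm_zero)
      from tendsto_power[OF this, of 2] show "(\<lambda>i. (norm (X w - s i w))\<^sup>2) \<longlonglongrightarrow> 0" by simp
    qed
    show "AE w in M. norm ((norm (X w - s i w))\<^sup>2) \<le> 9 * (norm (X w))\<^sup>2" for i
    proof (rule AE_I2)
      fix w assume "w \<in> space M"
      then have "norm (X w - s i w) \<le> 3 * norm (X w)"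
        using s(3)[of w i] norm_triangle_ineq4[of "X w" "s i w"] by simp
      from power_mono[OF this, of 2] show "norm ((norm (X w - s i w))\<^sup>2) \<le> 9 * (norm (X w))\<^sup>2"
        by (simp add: power_mult_distrib)
    qed
  qed (use int in auto)
  then have "(\<lambda>i. \<integral>w. (norm (X w - s i w))\<^sup>2 \<partial>M) \<longlonglongrightarrow> 0" by simp
  from order_tendstoD(2)[OF this d(1)] obtain i where "(\<integral>w. (norm (X w - s i w))\<^sup>2 \<partial>M) < d"
    by (auto simp: eventually_sequentially)
  with d(2)[OF sq] cov_op_simple_compact[OF s(1) sq] show "\<exists>L\<in>compact_ops. norm (cov_op M X - L) < e" by blast
qed

lemma continuous_on_cov_op:
  assumes sq: "\<And>x. x \<in> S \<Longrightarrow> square_integrable M (X x)" and cont: "L2_continuous_on M S X"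
  shows "continuous_on S (\<lambda>x. cov_op M (X x))"
  unfolding continuous_on
proof (intro ballI tendstoI)
  fix x and e :: real assume x: "x \<in> S" and "0 < e"
  obtain d where d: "0 < d"
    "\<And>Y. square_integrable M Y \<Longrightarrow> (\<integral>w. (norm (X x w - Y w))\<^sup>2 \<partial>M) < d \<Longrightarrow> norm (cov_op M (X x) - cov_op M Y) < e"
    using cov_op_close[OF sq[OF x] \<open>0 < e\<close>] by blast
  have "((\<lambda>y. L2_norm M (\<lambda>w. X y w - X x w)) \<longlongrightarrow> 0) (at x within S)"
    using cont x by (simp add: L2_continuous_on_def)
  then have "eventually (\<lambda>y. L2_norm M (\<lambda>w. X y w - X x w) < sqrt d) (at x within S)"
    using d(1) by (intro order_tendstoD) auto
  moreover have "eventually (\<lambda>y. y \<in> S) (at x within S)" by (simp add: eventually_at_filter)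
  ultimately show "eventually (\<lambda>y. dist (cov_op M (X y)) (cov_op M (X x)) < e) (at x within S)"
  proof eventually_elim
    case (elim y)
    then have "(\<integral>w. (norm (X x w - X y w))\<^sup>2 \<partial>M) < d"
      by (simp add: L2_norm_def norm_minus_commute)
    from d(2)[OF sq[OF elim(2)] this] show ?case by (simp add: dist_norm norm_minus_commute)
  qed
qed

section \<open>Projection error as a compressed trace\<close>

lemma integral_frame_proj_error:
  assumes X: "square_integrable M X" and f: "orthonormal_family m f"
  shows "(\<integral>w. (norm (X w - blinfun_apply (frame_proj m f) (X w)))\<^sup>2 \<partial>M) =
    (\<integral>w. (norm (X w))\<^sup>2 \<partial>M) - (\<Sum>j<m. blinfun_apply (cov_op M X) (f j) \<bullet> f j)"
  unfolding norm_sq_minus_frame_proj[OF f] cov_op_inner(1)[OF X]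
  using X cov_op_inner(2)[OF X] by (simp add: square_integrable_def power2_eq_square)

text \<open>Pointwise, the frame projection returns the point of the span nearest to
  \<open>X w\<close>, and \<open>Q (X w)\<close> is another point of that span.\<close>

lemma integral_frame_proj_error_le:
  assumes X: "square_integrable M X" and f: "orthonormal_family m f"
    and Q: "range (blinfun_apply Q) \<subseteq> span (f ` {..<m})"
  shows "(\<integral>w. (norm (X w - blinfun_apply (frame_proj m f) (X w)))\<^sup>2 \<partial>M) \<le>
    (\<integral>w. (norm (X w - blinfun_apply Q (X w)))\<^sup>2 \<partial>M)"
proof (rule integral_mono)
  have int: "integrable M (\<lambda>w. (norm (X w - blinfun_apply A (X w)))\<^sup>2)" for A
  proof -
    have [measurable]: "X \<in> borel_measurable M" "blinfun_apply A \<in> borel_measurable borel"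
      using X by (auto simp: square_integrable_def intro!: borel_measurable_continuous_onI continuous_intros)
    have "integrable M (\<lambda>w. (norm (blinfun_apply A (X w)))\<^sup>2)"
    proof (rule Bochner_Integration.integrable_bound[of _ "\<lambda>w. (norm A)\<^sup>2 * (norm (X w))\<^sup>2"])
      show "integrable M (\<lambda>w. (norm A)\<^sup>2 * (norm (X w))\<^sup>2)"
        using X by (simp add: square_integrable_def)
      show "AE w in M. norm ((norm (blinfun_apply A (X w)))\<^sup>2) \<le> norm ((norm A)\<^sup>2 * (norm (X w))\<^sup>2)"
        using power_mono[OF norm_blinfun norm_ge_zero, of A _ 2] by (intro AE_I2) (simp add: power_mult_distrib)
    qed measurable
    then have "square_integrable M (\<lambda>w. blinfun_apply A (X w))"
      by (simp add: square_integrable_def)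
    from square_integrable_diff[OF X this] show ?thesis by (simp add: square_integrable_def)
  qed
  show "integrable M (\<lambda>w. (norm (X w - blinfun_apply (frame_proj m f) (X w)))\<^sup>2)" by (rule int)
  show "integrable M (\<lambda>w. (norm (X w - blinfun_apply Q (X w)))\<^sup>2)" by (rule int)
  fix w
  show "(norm (X w - blinfun_apply (frame_proj m f) (X w)))\<^sup>2 \<le> (norm (X w - blinfun_apply Q (X w)))\<^sup>2"
    unfolding norm_sq_minus_frame_proj[OF f] using Q by (intro norm_sq_minus_span_ge[OF f]) blast
qed

text \<open>A competitor is replaced by the frame projection for an orthonormal basis of its range,
  which does not increase the error. Comparing errors then means comparing traces.\<close>

lemma gap_frame_proj_optimal:
  assumes X: "square_integrable M X" and gap: "gap_frame (cov_op M X) e l \<mu> n"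
  shows "(\<integral>w. (norm (X w - blinfun_apply (frame_proj n e) (X w)))\<^sup>2 \<partial>M) =
    (INF Q\<in>proj_rank_le n. \<integral>w. (norm (X w - blinfun_apply Q (X w)))\<^sup>2 \<partial>M)"
proof (rule sym, rule cInf_eq_minimum)
  have e: "orthonormal_family n e" using gap by (simp add: gap_frame_def spec_frame_def)
  have "frame_proj n e \<in> proj_rank_le n"
    by (simp add: proj_rank_le_def frame_proj_compact frame_proj_orth_proj[OF e] op_rank_frame_proj[OF e])
  then show "(\<integral>w. (norm (X w - blinfun_apply (frame_proj n e) (X w)))\<^sup>2 \<partial>M) \<in>
      (\<lambda>Q. \<integral>w. (norm (X w - blinfun_apply Q (X w)))\<^sup>2 \<partial>M) ` proj_rank_le n" by (rule imageI)
  fix z assume "z \<in> (\<lambda>Q. \<integral>w. (norm (X w - blinfun_apply Q (X w)))\<^sup>2 \<partial>M) ` proj_rank_le n"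
  then obtain Q where Q: "op_rank Q \<le> enat n" and z: "z = (\<integral>w. (norm (X w - blinfun_apply Q (X w)))\<^sup>2 \<partial>M)"
    by (auto simp: proj_rank_le_def)
  from Q obtain S where S: "finite S" "span S = range (blinfun_apply Q)" "card S \<le> n" by (rule op_rank_leD)
  obtain m f where f: "m \<le> card S" "orthonormal_family m f" "span (f ` {..<m}) = span S"
    using orthonormal_family_of_finite[OF S(1)] by blast
  \<comment> \<open>With constant 0 the trace inequality says just that no frame of
    \<open>m \<le> n\<close> vectors has a larger trace than \<open>e\<close>.\<close>
  have "0 * (\<Sum>i<n. 1 - (\<Sum>j<m. (e i \<bullet> f j)\<^sup>2)) \<le> (\<Sum>i<n. blinfun_apply (cov_op M X) (e i) \<bullet> e i) -
      (\<Sum>j<m. blinfun_apply (cov_op M X) (f j) \<bullet> f j)"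
    using f(1) S(3) gap
    by (intro gap_frame_trace[OF psd_op_cov_op[OF X] gap f(2)]) (auto simp: gap_frame_def less_imp_le)
  then have "(\<integral>w. (norm (X w - blinfun_apply (frame_proj n e) (X w)))\<^sup>2 \<partial>M) \<le>
      (\<integral>w. (norm (X w - blinfun_apply (frame_proj m f) (X w)))\<^sup>2 \<partial>M)"
    by (simp add: integral_frame_proj_error[OF X e] integral_frame_proj_error[OF X f(2)])
  also have "\<dots> \<le> z"
    unfolding z using S(2) f(3) by (intro integral_frame_proj_error_le[OF X f(2)]) simp
  finally show "(\<integral>w. (norm (X w - blinfun_apply (frame_proj n e) (X w)))\<^sup>2 \<partial>M) \<le> z" .
qed

subsection \<open>Frames over contractible sets\<close>

text \<open>Each \<open>v i\<close> is its own projection onto the span of \<open>e\<close>, so all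
  defects vanish and the norm bound forces equality. One inclusion of spans suffices because both
  families have \<open>n\<close> members.\<close>

lemma frame_proj_eqI:
  assumes e: "orthonormal_family n e" and v: "orthonormal_family n v" and sub: "\<And>i. i < n \<Longrightarrow> v i \<in> span (e ` {..<n})"
  shows "frame_proj n e = frame_proj n v"
proof -
  have "1 - (\<Sum>j<n. (v i \<bullet> e j)\<^sup>2) = 0" if "i < n" for i
    using norm_sq_minus_frame_proj[OF e, of "v i"] frame_proj_fix[OF e sub[OF that]] orthonormal_family_norm[OF v that]
    by simp
  then have "(\<Sum>i<n. 1 - (\<Sum>j<n. (v i \<bullet> e j)\<^sup>2)) = 0" by simp
  with norm_frame_proj_diff_le[OF v e] show ?thesis by simp
qed

text \<open>The staircase condition keeps the residual \<open>w x\<close> of the next vector nonzero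
  on \<open>S\<close>, so dividing by its norm preserves continuity.\<close>

lemma continuous_gram_schmidt:
  fixes u :: "nat \<Rightarrow> 'x::topological_space \<Rightarrow> 'h::real_inner"
  assumes "\<And>i. i < n \<Longrightarrow> continuous_on S (u i)"
    and "\<And>x i. x \<in> S \<Longrightarrow> i < n \<Longrightarrow> u i x \<notin> span ((\<lambda>j. u j x) ` {..<i})"
  shows "\<exists>v. (\<forall>i<n. continuous_on S (v i)) \<and>
    (\<forall>x\<in>S. orthonormal_family n (\<lambda>i. v i x) \<and> (\<forall>i<n. v i x \<in> span ((\<lambda>j. u j x) ` {..<n})))"
  using assms
proof (induction n)
  case 0
  show ?case by (simp add: orthonormal_family_def)
next
  case (Suc n)
  have "\<exists>v. (\<forall>i<n. continuous_on S (v i)) \<and>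
    (\<forall>x\<in>S. orthonormal_family n (\<lambda>i. v i x) \<and> (\<forall>i<n. v i x \<in> span ((\<lambda>j. u j x) ` {..<n})))"
    using Suc.prems by (intro Suc.IH) auto
  then obtain v where v: "\<And>i. i < n \<Longrightarrow> continuous_on S (v i)"
    "\<And>x. x \<in> S \<Longrightarrow> orthonormal_family n (\<lambda>i. v i x)"
    "\<And>x i. x \<in> S \<Longrightarrow> i < n \<Longrightarrow> v i x \<in> span ((\<lambda>j. u j x) ` {..<n})" by blast
  define w where "w x = u n x - (\<Sum>i<n. (u n x \<bullet> v i x) *\<^sub>R v i x)" for x
  have sum_span: "(\<Sum>i<n. (u n x \<bullet> v i x) *\<^sub>R v i x) \<in> span ((\<lambda>j. u j x) ` {..<n})" if "x \<in> S" for x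
    by (rule span_sum, rule span_scale) (use v(3)[OF that] in auto)
  have w0: "w x \<noteq> 0" if "x \<in> S" for x
    using sum_span[OF that] Suc.prems(2)[OF that, of n] by (auto simp: w_def)
  have w_perp: "w x \<bullet> v i x = 0" if "x \<in> S" "i < n" for x i
    using orthonormal_family_inner_sum[OF v(2)[OF that(1)] that(2)] by (simp add: w_def inner_diff_left)
  define v' where "v' = v(n := (\<lambda>x. (1 / norm (w x)) *\<^sub>R w x))"
  have "continuous_on S w"
    unfolding w_def using v(1) Suc.prems(1) by (intro continuous_intros) auto
  then have "continuous_on S (\<lambda>x. (1 / norm (w x)) *\<^sub>R w x)"
    using w0 by (intro continuous_intros) auto
  then have "\<forall>i<Suc n. continuous_on S (v' i)"
    using v(1) by (simp add: v'_def less_Suc_eq)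
  moreover have "orthonormal_family (Suc n) (\<lambda>i. v' i x)" if "x \<in> S" for x
  proof -
    have "(1 / norm (w x)) *\<^sub>R w x \<bullet> (1 / norm (w x)) *\<^sub>R w x = 1"
      using w0[OF that] by (simp add: dot_square_norm power2_eq_square)
    then show ?thesis
      using v(2)[OF that] w_perp[OF that]
      by (auto simp: v'_def orthonormal_family_def less_Suc_eq inner_commute)
  qed
  moreover have "v' i x \<in> span ((\<lambda>j. u j x) ` {..<Suc n})" if "x \<in> S" "i < Suc n" for x i
  proof -
    have mono: "span ((\<lambda>j. u j x) ` {..<n}) \<subseteq> span ((\<lambda>j. u j x) ` {..<Suc n})"
      by (intro span_mono image_mono) auto
    have "w x \<in> span ((\<lambda>j. u j x) ` {..<Suc n})"
      unfolding w_def by (intro span_diff span_base subsetD[OF mono sum_span[OF that(1)]]) simp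
    then show ?thesis using that v(3)[OF that(1)] mono
      by (auto simp: v'_def less_Suc_eq intro: span_scale)
  qed
  ultimately show ?case by (intro exI[of _ v']) auto
qed

text \<open>A tube argument by sequences: failing pairs of times at points tending to
  \<open>x\<close> have, by compactness of the interval, a subsequence along which both times tend
  to one \<open>\<sigma>\<close>. Both values of \<open>R\<close> then tend to
  \<open>R (\<sigma>, x)\<close>, although they stay at distance at least 1.\<close>

lemma uniform_step_nbhd:
  fixes R :: "real \<times> 'x::metric_space \<Rightarrow> 'b::real_normed_vector"
  assumes cont: "continuous_on ({0..1} \<times> S) R" and x: "x \<in> S"
  obtains r where "0 < r"
    "\<And>y s t. y \<in> S \<Longrightarrow> s \<in> {0..1} \<Longrightarrow> t \<in> {0..1} \<Longrightarrow> dist x y < r \<Longrightarrow> \<bar>s - t\<bar> < r \<Longrightarrow> norm (R (s, y) - R (t, y)) < 1"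
proof (rule ccontr)
  assume "\<not> thesis"
  then have "\<forall>k. \<exists>y s t. y \<in> S \<and> s \<in> {0..1} \<and> t \<in> {0..1} \<and> dist x y < 1 / real (Suc k) \<and>
      \<bar>s - t\<bar> < 1 / real (Suc k) \<and> 1 \<le> norm (R (s, y) - R (t, y))"
    using that by (metis not_less of_nat_0_less_iff zero_less_Suc zero_less_divide_1_iff)
  then obtain y s t where *: "\<And>k. y k \<in> S" "\<And>k. s k \<in> {0..1}" "\<And>k. t k \<in> {0..1}"
    "\<And>k. dist x (y k) < 1 / real (Suc k)" "\<And>k. \<bar>s k - t k\<bar> < 1 / real (Suc k)"
    "\<And>k. 1 \<le> norm (R (s k, y k) - R (t k, y k))"
    by metis
  obtain \<sigma> r where \<sigma>: "\<sigma> \<in> {0..1}" "strict_mono (r :: nat \<Rightarrow> nat)" "(s \<circ> r) \<longlonglongrightarrow> \<sigma>"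
    using *(2) compact_imp_seq_compact[OF compact_Icc[of "0::real" 1]] by (metis seq_compactE)
  have inv: "(\<lambda>k. 1 / real (Suc k)) \<longlonglongrightarrow> 0"
    using LIMSEQ_inverse_real_of_nat by (simp add: inverse_eq_divide)
  have "(\<lambda>k. dist (y k) x) \<longlonglongrightarrow> 0"
    by (rule Lim_null_comparison[OF _ inv]) (use *(4) in \<open>auto intro!: always_eventually less_imp_le simp: dist_commute\<close>)
  then have "y \<longlonglongrightarrow> x" by (rule tendsto_dist_iff[THEN iffD2])
  from LIMSEQ_subseq_LIMSEQ[OF this \<sigma>(2)] have y: "(\<lambda>k. y (r k)) \<longlonglongrightarrow> x" by (simp add: comp_def)
  have "(\<lambda>k. s k - t k) \<longlonglongrightarrow> 0"
    by (rule Lim_null_comparison[OF _ inv]) (use *(5) in \<open>auto intro!: always_eventually less_imp_le\<close>)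
  from LIMSEQ_subseq_LIMSEQ[OF this \<sigma>(2)] have st: "(\<lambda>k. s (r k) - t (r k)) \<longlonglongrightarrow> 0" by (simp add: comp_def)
  have s: "(\<lambda>k. s (r k)) \<longlonglongrightarrow> \<sigma>" using \<sigma>(3) by (simp add: comp_def)
  from tendsto_diff[OF s st] have t: "(\<lambda>k. t (r k)) \<longlonglongrightarrow> \<sigma>" by simp
  have lim: "(\<lambda>k. R (q k, y (r k))) \<longlonglongrightarrow> R (\<sigma>, x)" if "q \<longlonglongrightarrow> \<sigma>" "\<And>k. q k \<in> {0..1}" for q
    by (rule continuous_on_tendsto_compose[OF cont tendsto_Pair[OF that(1) y]])
       (use \<sigma>(1) x that(2) *(1) in \<open>auto simp del: atLeastAtMost_iff\<close>)
  have "(\<lambda>k. norm (R (s (r k), y (r k)) - R (t (r k), y (r k)))) \<longlonglongrightarrow> norm (R (\<sigma>, x) - R (\<sigma>, x))"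
    by (intro tendsto_intros lim s t *(2,3))
  then have "1 \<le> norm (R (\<sigma>, x) - R (\<sigma>, x))"
    by (rule LIMSEQ_le_const) (use *(6) in blast)
  then show False by simp
qed

text \<open>The distance to the set of bad step sizes is a continuous admissible step size; this
  replaces a partition of unity.\<close>

lemma continuous_step_size:
  fixes R :: "real \<times> 'x::metric_space \<Rightarrow> 'b::real_normed_vector"
  assumes cont: "continuous_on ({0..1} \<times> S) R"
  obtains \<delta> where "continuous_on S \<delta>" "\<And>x. x \<in> S \<Longrightarrow> 0 < \<delta> x"
    "\<And>x s t. x \<in> S \<Longrightarrow> s \<in> {0..1} \<Longrightarrow> t \<in> {0..1} \<Longrightarrow> \<bar>s - t\<bar> < \<delta> x \<Longrightarrow> norm (R (s, x) - R (t, x)) < 1"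
proof -
  \<comment> \<open>Pairs of a point and the length of a bad step there. The slice at height 1 keeps
    the set nonempty, since \<open>infdist\<close> to the empty set is 0 and would give no positive
    step.\<close>
  define Bad where "Bad = UNIV \<times> {1} \<union>
    {(y, \<bar>s - t\<bar>) | y s t. y \<in> S \<and> s \<in> {0..1} \<and> t \<in> {0..1} \<and> 1 \<le> norm (R (s, y) - R (t, y))}"
  have ne: "Bad \<noteq> {}" by (auto simp: Bad_def)
  show thesis
  proof (rule that[of "\<lambda>x. infdist (x, 0) Bad"])
    show "continuous_on S (\<lambda>x. infdist (x, 0) Bad)" by (intro continuous_intros)
    fix x assume x: "x \<in> S"
    obtain r where r: "0 < r" "\<And>y s t. y \<in> S \<Longrightarrow> s \<in> {0..1} \<Longrightarrow> t \<in> {0..1} \<Longrightarrow> dist x y < r \<Longrightarrow>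
        \<bar>s - t\<bar> < r \<Longrightarrow> norm (R (s, y) - R (t, y)) < 1"
      using uniform_step_nbhd[OF cont x] by blast
    \<comment> \<open>A bad pair has its point at distance at least \<open>r\<close> from
      \<open>x\<close> or its step length at least \<open>r\<close>, and the added slice is at
      distance at least 1, so a whole ball around \<open>(x, 0)\<close> avoids
      \<open>Bad\<close>.\<close>
    have "min r 1 \<le> infdist (x, 0) Bad"
      unfolding infdist_notempty[OF ne]
    proof (rule cINF_greatest[OF ne])
      fix z assume z: "z \<in> Bad"
      have d: "dist x (fst z) \<le> dist (x, 0) z" "\<bar>snd z\<bar> \<le> dist (x, 0) z"
        using dist_fst_le[of "(x, 0)" z] dist_snd_le[of "(x, 0)" z] by (auto simp: dist_real_def)
      from z consider "snd z = 1" | y s t where "z = (y, \<bar>s - t\<bar>)" "y \<in> S" "s \<in> {0..1}" "t \<in> {0..1}"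
          "1 \<le> norm (R (s, y) - R (t, y))"
        unfolding Bad_def by auto
      then show "min r 1 \<le> dist (x, 0) z"
      proof cases
        case 1
        then show ?thesis using d(2) by simp
      next
        case 2
        have "\<not> (dist x y < r \<and> \<bar>s - t\<bar> < r)" using r(2)[OF 2(2-4)] 2(5) by auto
        then show ?thesis using d 2(1) by auto
      qed
    qed
    then show "0 < infdist (x, 0) Bad" using r(1) by linarith
    fix s t :: real assume st: "s \<in> {0..1}" "t \<in> {0..1}" "\<bar>s - t\<bar> < infdist (x, 0) Bad"
    have "(x, \<bar>s - t\<bar>) \<notin> Bad"
    proof
      assume "(x, \<bar>s - t\<bar>) \<in> Bad"
      from infdist_le[OF this, of "(x, 0)"] show False
        using st(3) by (simp add: dist_prod_def dist_real_def)
    qed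
    then show "norm (R (s, x) - R (t, x)) < 1" using x st(1,2) unfolding Bad_def by force
  qed
qed

text \<open>A relation among the images pulls back by injectivity to \<open>e i\<close> lying in the
  span of the earlier vectors, which orthogonality forbids. This supplies the hypothesis of
  \<open>continuous_gram_schmidt\<close>.\<close>

lemma linear_image_staircase:
  assumes "linear T" and e: "orthonormal_family n e"
    and inj: "\<And>z. z \<in> span (e ` {..<n}) \<Longrightarrow> T z = 0 \<Longrightarrow> z = 0" and "i < n"
  shows "T (e i) \<notin> span ((\<lambda>j. T (e j)) ` {..<i})"
proof
  assume "T (e i) \<in> span ((\<lambda>j. T (e j)) ` {..<i})"
  also have "(\<lambda>j. T (e j)) ` {..<i} = T ` e ` {..<i}" by (simp add: image_image)
  also have "span (T ` e ` {..<i}) = T ` span (e ` {..<i})" by (rule linear_span_image[OF assms(1)])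
  finally obtain y where y: "y \<in> span (e ` {..<i})" "T (e i) = T y" by blast
  have "span (e ` {..<i}) \<subseteq> span (e ` {..<n})"
    using \<open>i < n\<close> by (intro span_mono image_mono) auto
  then have "y \<in> span (e ` {..<n})" using y(1) by blast
  moreover have "e i \<in> span (e ` {..<n})" using \<open>i < n\<close> by (intro span_base) simp
  ultimately have "e i - y \<in> span (e ` {..<n})" by (rule span_diff[rotated])
  moreover have "T (e i - y) = 0" using y(2) by (simp add: linear_diff[OF assms(1)])
  ultimately have "e i = y" using inj[of "e i - y"] by simp
  have "e i \<bullet> z = 0" if "z \<in> span (e ` {..<i})" for z
    using that
  proof (induction rule: span_induct_alt)
    case (step c z w)
    then show ?case using orthonormal_familyD[OF e \<open>i < n\<close>] \<open>i < n\<close>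
      by (auto simp: inner_add_right)
  qed simp
  from this[OF y(1)] show False
    using orthonormal_family_norm[OF e \<open>i < n\<close>] \<open>e i = y\<close> by simp
qed

text \<open>The number of steps along the path depends on the point and may be unbounded on
  \<open>S\<close>. Once the path has arrived, further projections leave the transported vectors
  unchanged, so locally one fixed number of steps can be used, which gives continuity.\<close>

lemma contractible_frame:
  fixes S :: "'x::metric_space set" and e :: "'x \<Rightarrow> nat \<Rightarrow> 'h::real_inner"
  assumes "contractible S" and cont: "continuous_on S (\<lambda>x. frame_proj n (e x))"
    and e: "\<And>x. x \<in> S \<Longrightarrow> orthonormal_family n (e x)"
  obtains v where "\<And>i. i < n \<Longrightarrow> continuous_on S (v i)"
    "\<And>x. x \<in> S \<Longrightarrow> orthonormal_family n (\<lambda>i. v i x) \<and> frame_proj n (e x) = frame_proj n (\<lambda>i. v i x)"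
proof -
  obtain a h where h: "continuous_on ({0..1} \<times> S) h" "h \<in> {0..1::real} \<times> S \<rightarrow> S"
    "\<And>x. h (0, x) = x" "\<And>x. h (1, x) = a"
    using assms(1) unfolding contractible_def homotopic_with_def by auto
  define R where "R z = frame_proj n (e (h z))" for z
  have hS: "h (t, x) \<in> S" if "t \<in> {0..1}" "x \<in> S" for t x using h(2) that by auto
  have contR: "continuous_on ({0..1} \<times> S) R"
    unfolding R_def by (rule continuous_on_compose2[OF cont h(1)]) (use h(2) in auto)
  have R_fix: "blinfun_apply (R (t, x)) z = z"
    if "t \<in> {0..1}" "x \<in> S" "z \<in> range (blinfun_apply (R (t, x)))" for t x z
    using that frame_proj_fix[OF e[OF hS[OF that(1,2)]]] range_frame_proj[OF e[OF hS[OF that(1,2)]]]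
    by (simp add: R_def)
  obtain \<delta> where \<delta>: "continuous_on S \<delta>" "\<And>x. x \<in> S \<Longrightarrow> 0 < \<delta> x"
    "\<And>x s t. x \<in> S \<Longrightarrow> s \<in> {0..1} \<Longrightarrow> t \<in> {0..1} \<Longrightarrow> \<bar>s - t\<bar> < \<delta> x \<Longrightarrow> norm (R (s, x) - R (t, x)) < 1"
    using continuous_step_size[OF contR] by blast
  \<comment> \<open>Times run backwards from 1, where the contraction sits at \<open>a\<close>, to
    0, where it is the identity. Half of \<open>\<delta> x\<close> makes each step strictly
    admissible, and the cut at 0 stops the path there.\<close>
  define \<tau> where "\<tau> k x = max 0 (1 - real k * (\<delta> x / 2))" for k x
  have \<tau>01: "\<tau> k x \<in> {0..1}" if "x \<in> S" for k x using \<delta>(2)[OF that] by (simp add: \<tau>_def)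
  have \<tau>_step: "\<bar>\<tau> (Suc k) x - \<tau> k x\<bar> < \<delta> x" if "x \<in> S" for k x
    using \<delta>(2)[OF that] by (auto simp: \<tau>_def max_def algebra_simps abs_if)
  have cont\<tau>: "continuous_on S (\<lambda>x. R (\<tau> k x, x))" for k
    by (rule continuous_on_compose2[OF contR])
       (use \<tau>01 in \<open>auto simp: \<tau>_def simp del: atLeastAtMost_iff intro!: continuous_intros \<delta>(1)\<close>)
  \<comment> \<open>Time \<open>\<tau> 0 x = 1\<close> contributes no factor: the starting vectors
    already lie in the range of the projection at that time.\<close>
  define T where "T k x = rec_nat id_blinfun (\<lambda>k A. R (\<tau> (Suc k) x, x) o\<^sub>L A) k" for k x
  have T0: "T 0 x = id_blinfun" and TSuc: "T (Suc k) x = R (\<tau> (Suc k) x, x) o\<^sub>L T k x" for k x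
    by (simp_all add: T_def)
  have contT: "continuous_on S (T k)" for k
  proof (induction k)
    case 0
    show ?case by (simp add: T0[abs_def])
  next
    case (Suc k)
    show ?case
      using bounded_bilinear.continuous_on[OF bounded_bilinear_blinfun_compose cont\<tau> Suc] by (simp add: TSuc)
  qed
  let ?V = "span (e a ` {..<n})"
  show thesis
  \<comment> \<open>The point \<open>a\<close> is known to lie in \<open>S\<close> only if
    \<open>S\<close> is nonempty.\<close>
  proof (cases "S = {}")
    case True
    then show thesis using that by simp
  next
    case False
    then obtain x0 where "x0 \<in> S" by blast
    then have "a \<in> S" using hS[of 1 x0] h(4) by simp
    note ea = e[OF this]
    have T_mem: "blinfun_apply (T k x) z \<in> range (blinfun_apply (R (\<tau> k x, x)))" if "x \<in> S" "z \<in> ?V" for k x z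
    proof (cases k)
      case 0
      have "R (\<tau> 0 x, x) = frame_proj n (e a)" by (simp add: R_def \<tau>_def h(4))
      then show ?thesis using that(2) 0 by (simp add: T0 range_frame_proj[OF ea])
    next
      case (Suc j)
      then show ?thesis by (simp add: TSuc)
    qed
    have T_inj: "z = 0" if "x \<in> S" "z \<in> ?V" "blinfun_apply (T k x) z = 0" for k x z
      using that(3)
    proof (induction k)
      case 0
      then show ?case by (simp add: T0)
    next
      case (Suc k)
      let ?P = "R (\<tau> k x, x)" and ?Q = "R (\<tau> (Suc k) x, x)" and ?u = "blinfun_apply (T k x) z"
      have Q: "blinfun_apply ?Q ?u = 0" using Suc.prems by (simp add: TSuc)
      have P: "blinfun_apply ?P ?u = ?u" using R_fix[OF \<tau>01[OF that(1)] that(1) T_mem[OF that(1,2)]] .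
      \<comment> \<open>Since \<open>?P\<close> fixes \<open>?u\<close> and \<open>?Q\<close> kills
        it, \<open>?Q - ?P\<close> preserves its norm; an operator norm below 1 leaves only
        \<open>?u = 0\<close>.\<close>
      have "norm ?u = norm (blinfun_apply (?Q - ?P) ?u)" using P Q by (simp add: blinfun.diff_left)
      also have "\<dots> \<le> norm (?Q - ?P) * norm ?u" by (rule norm_blinfun)
      finally have "norm ?u \<le> norm (?Q - ?P) * norm ?u" .
      moreover have "norm (?Q - ?P) < 1" using \<delta>(3)[OF that(1) \<tau>01 \<tau>01 \<tau>_step] that(1) by simp
      ultimately have "?u = 0"
        by (metis less_eq_real_def linorder_not_le mult_less_cancel_right2 norm_le_zero_iff zero_less_norm_iff)
      then show ?case by (rule Suc.IH)
    qed
    \<comment> \<open>From \<open>2 \<le> real k * \<delta> x\<close> on all times are 0, so further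
      factors repeat one projection, which fixes the vectors in its range.\<close>
    have T_stable: "blinfun_apply (T (k + m) x) z = blinfun_apply (T k x) z"
      if "x \<in> S" "z \<in> ?V" "2 \<le> real k * \<delta> x" for k m x z
    proof (induction m)
      case (Suc m)
      have "2 \<le> real j * \<delta> x" if "j \<ge> k" for j
        by (rule order_trans[OF \<open>2 \<le> real k * \<delta> x\<close> mult_right_mono]) (use that \<delta>(2)[OF \<open>x \<in> S\<close>] in auto)
      then have "\<tau> j x = 0" if "j \<ge> k" for j using that by (force simp: \<tau>_def)
      then have "\<tau> (Suc (k + m)) x = \<tau> (k + m) x" by simp
      then have "blinfun_apply (T (Suc (k + m)) x) z = blinfun_apply (R (\<tau> (k + m) x, x)) (blinfun_apply (T (k + m) x) z)"
        by (simp add: TSuc)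
      also have "\<dots> = blinfun_apply (T (k + m) x) z"
        using R_fix[OF \<tau>01[OF that(1)] that(1) T_mem[OF that(1,2)]] .
      finally show ?case using Suc by simp
    qed simp
    define N where "N x = nat \<lceil>2 / \<delta> x\<rceil>" for x
    have N: "2 \<le> real k * \<delta> x" if "x \<in> S" "N x \<le> k" for k x
    proof -
      have "2 / \<delta> x \<le> real k" using that(2) unfolding N_def by linarith
      then show ?thesis using \<delta>(2)[OF that(1)] by (simp add: pos_divide_le_eq)
    qed
    define u where "u i x = blinfun_apply (T (N x) x) (e a i)" for i x
    have eV: "e a i \<in> ?V" if "i < n" for i using that by (intro span_base) simp
    have u_eq: "u i x = blinfun_apply (T k x) (e a i)" if "x \<in> S" "i < n" "N x \<le> k" for i k x
      using T_stable[OF that(1) eV[OF that(2)] N[OF that(1) order_refl], of "k - N x"] that(3) by (simp add: u_def)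
    have u_cont: "continuous_on S (u i)" if i: "i < n" for i
      unfolding continuous_on
    proof
      fix x assume x: "x \<in> S"
      \<comment> \<open>One step beyond \<open>N x\<close> makes the arrival condition strict at
        \<open>x\<close>, hence by continuity of \<open>\<delta>\<close> valid at all nearby points
        of \<open>S\<close>; there \<open>u i\<close> agrees with a map that is continuous because
        \<open>T ?k\<close> is.\<close>
      let ?k = "N x + 1"
      have "2 < real ?k * \<delta> x" using N[OF x order_refl] \<delta>(2)[OF x] by (simp add: algebra_simps)
      moreover have "((\<lambda>y. real ?k * \<delta> y) \<longlongrightarrow> real ?k * \<delta> x) (at x within S)"
        using \<delta>(1) x by (intro tendsto_intros) (auto simp: continuous_on)
      ultimately have "eventually (\<lambda>y. 2 < real ?k * \<delta> y) (at x within S)" by (rule order_tendstoD(1)[rotated])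
      moreover have "eventually (\<lambda>y. y \<in> S) (at x within S)" by (simp add: eventually_at_filter)
      ultimately have "eventually (\<lambda>y. blinfun_apply (T ?k y) (e a i) = u i y) (at x within S)"
      proof eventually_elim
        case (elim y)
        then have "2 / \<delta> y \<le> real ?k" using \<delta>(2)[of y] by (simp add: pos_divide_le_eq)
        then have "N y \<le> ?k" unfolding N_def by linarith
        then show ?case using u_eq[of y i ?k] elim i by simp
      qed
      moreover have "((\<lambda>y. blinfun_apply (T ?k y) (e a i)) \<longlongrightarrow> blinfun_apply (T ?k x) (e a i)) (at x within S)"
        using contT[of ?k] x by (intro tendsto_intros) (auto simp: continuous_on)
      ultimately have "(u i \<longlongrightarrow> blinfun_apply (T ?k x) (e a i)) (at x within S)"
        by (rule Lim_transform_eventually[rotated])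
      then show "(u i \<longlongrightarrow> u i x) (at x within S)" using u_eq[OF x i, of ?k] by simp
    qed
    have u_indep: "u i x \<notin> span ((\<lambda>j. u j x) ` {..<i})" if "x \<in> S" "i < n" for i x
      unfolding u_def
      by (rule linear_image_staircase[OF bounded_linear.linear[OF blinfun.bounded_linear_right] ea _ that(2)])
         (rule T_inj[OF that(1)])
    have u_mem: "u i x \<in> span (e x ` {..<n})" if "x \<in> S" "i < n" for i x
    proof -
      have "\<tau> (N x) x = 0" using N[OF that(1) order_refl] by (simp add: \<tau>_def)
      then have "R (\<tau> (N x) x, x) = frame_proj n (e x)" by (simp add: R_def h(3))
      then show ?thesis
        using T_mem[OF that(1) eV[OF that(2)], of "N x"] by (simp add: u_def range_frame_proj[OF e[OF that(1)]])
    qed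
    obtain v where v: "\<And>i. i < n \<Longrightarrow> continuous_on S (v i)"
      "\<And>x. x \<in> S \<Longrightarrow> orthonormal_family n (\<lambda>i. v i x)"
      "\<And>x i. x \<in> S \<Longrightarrow> i < n \<Longrightarrow> v i x \<in> span ((\<lambda>j. u j x) ` {..<n})"
      using continuous_gram_schmidt[of n S u] u_cont u_indep by blast
    have "frame_proj n (e x) = frame_proj n (\<lambda>i. v i x)" if "x \<in> S" for x
    proof (rule frame_proj_eqI[OF e[OF that] v(2)[OF that]])
      fix i assume "i < n"
      have "span ((\<lambda>j. u j x) ` {..<n}) \<subseteq> span (e x ` {..<n})"
        by (rule span_minimal) (use u_mem[OF that] in auto)
      then show "v i x \<in> span (e x ` {..<n})" using v(3)[OF that \<open>i < n\<close>] by blast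
    qed
    then show thesis using that v(1,2) by blast
  qed
qed

section \<open>Continuity, optimality and frames of the best projections of rank
  \<open>n\<close>\<close>

theorem theorem8:
  fixes M :: "'w measure"
    and \<Xi> :: "'x::metric_space set"
    and X :: "'x \<Rightarrow> 'w \<Rightarrow> 'h::{real_inner, banach, second_countable_topology}"
    and n :: nat
  assumes "prob_space M" and "complete_measure M" and "separable_measure M"
    and "\<And>\<xi>. \<xi> \<in> \<Xi> \<Longrightarrow> square_integrable M (X \<xi>)"
    and "L2_continuous_on M \<Xi> X"
    and "n \<ge> 1"
    and "\<And>\<xi>. \<xi> \<in> \<Xi> \<Longrightarrow>
           sing_val n (cov_op M (X \<xi>)) > sing_val (n + 1) (cov_op M (X \<xi>)) \<and>
           sing_val (n + 1) (cov_op M (X \<xi>)) \<ge> 0"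
  shows "\<exists>P :: 'x \<Rightarrow> 'h \<Rightarrow>\<^sub>L 'h.
           continuous_on \<Xi> P \<and>
           (\<forall>\<xi>\<in>\<Xi>. P \<xi> \<in> compact_ops \<and> orth_proj (P \<xi>) \<and> op_rank (P \<xi>) = enat n \<and>
              (\<integral>w. (norm (X \<xi> w - P \<xi> (X \<xi> w)))\<^sup>2 \<partial>M) =
              (INF Q\<in>proj_rank_le n. \<integral>w. (norm (X \<xi> w - blinfun_apply Q (X \<xi> w)))\<^sup>2 \<partial>M)) \<and>
           (contractible \<Xi> \<longrightarrow>
              (\<exists>v :: nat \<Rightarrow> 'x \<Rightarrow> 'h.
                 (\<forall>i\<in>{1..n}. continuous_on \<Xi> (v i)) \<and>
                 (\<forall>\<xi>\<in>\<Xi>.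
                    (\<forall>i\<in>{1..n}. \<forall>j\<in>{1..n}. v i \<xi> \<bullet> v j \<xi> = (if i = j then 1 else 0)) \<and>
                    (\<forall>x. P \<xi> x = (\<Sum>i=1..n. (x \<bullet> v i \<xi>) *\<^sub>R v i \<xi>)))))"
proof -
  interpret prob_space M by fact
  let ?B = "\<lambda>\<xi>. cov_op M (X \<xi>)"
  have "\<exists>e l \<mu>. gap_frame (?B \<xi>) e l \<mu> n" if "\<xi> \<in> \<Xi>" for \<xi>
    using assms(4,6,7) that by (intro exists_gap_frame cov_op_compact psd_op_cov_op) auto
  then obtain e l \<mu> where gap: "\<And>\<xi>. \<xi> \<in> \<Xi> \<Longrightarrow> gap_frame (?B \<xi>) (e \<xi>) (l \<xi>) (\<mu> \<xi>) n" by metis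
  then have on: "orthonormal_family n (e \<xi>)" if "\<xi> \<in> \<Xi>" for \<xi>
    using that by (auto simp: gap_frame_def spec_frame_def)
  let ?P = "\<lambda>\<xi>. frame_proj n (e \<xi>)"
  have cont: "continuous_on \<Xi> ?P"
    using continuous_on_gap_frame_proj[OF continuous_on_cov_op[OF assms(4,5)] psd_op_cov_op[OF assms(4)] gap] .
  have frame: "\<exists>v. (\<forall>i\<in>{1..n}. continuous_on \<Xi> (v i)) \<and>
      (\<forall>\<xi>\<in>\<Xi>. (\<forall>i\<in>{1..n}. \<forall>j\<in>{1..n}. v i \<xi> \<bullet> v j \<xi> = (if i = j then 1 else 0)) \<and>
        (\<forall>x. ?P \<xi> x = (\<Sum>i=1..n. (x \<bullet> v i \<xi>) *\<^sub>R v i \<xi>)))" if ctr: "contractible \<Xi>"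
  proof -
    obtain v where v: "\<And>i. i < n \<Longrightarrow> continuous_on \<Xi> (v i)"
      "\<And>\<xi>. \<xi> \<in> \<Xi> \<Longrightarrow> orthonormal_family n (\<lambda>i. v i \<xi>) \<and> ?P \<xi> = frame_proj n (\<lambda>i. v i \<xi>)"
      using contractible_frame[OF ctr cont on] by blast
    \<comment> \<open>Index shift: orthonormal families count from 0, the frame of the statement
      from 1.\<close>
    have "(\<Sum>i<n. (x \<bullet> v i \<xi>) *\<^sub>R v i \<xi>) = (\<Sum>i=1..n. (x \<bullet> v (i - 1) \<xi>) *\<^sub>R v (i - 1) \<xi>)" for x \<xi>
      by (rule sum.reindex_bij_witness[of _ "\<lambda>i. i - 1" Suc]) auto
    then show ?thesis
      using v by (intro exI[of _ "\<lambda>i. v (i - 1)"]) (auto simp: frame_proj_apply orthonormal_family_def)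
  qed
  show ?thesis
  proof (intro exI[of _ ?P] conjI ballI impI cont frame)
    fix \<xi> assume "\<xi> \<in> \<Xi>"
    then show "?P \<xi> \<in> compact_ops" "orth_proj (?P \<xi>)" "op_rank (?P \<xi>) = enat n"
      by (simp_all add: frame_proj_compact frame_proj_orth_proj op_rank_frame_proj on)
    show "(\<integral>w. (norm (X \<xi> w - ?P \<xi> (X \<xi> w)))\<^sup>2 \<partial>M) =
        (INF Q\<in>proj_rank_le n. \<integral>w. (norm (X \<xi> w - blinfun_apply Q (X \<xi> w)))\<^sup>2 \<partial>M)"
      using gap_frame_proj_optimal[OF assms(4) gap] \<open>\<xi> \<in> \<Xi>\<close> by blast
  qed
qed

end
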